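(* Let $k$ be a field of characteristic $0$ and let $H$ be a connected graded Hopf algebra over $k$. Then there exist an indexed family $\{z_\gamma\}_{\gamma\in\Gamma}$ of homogeneous elements of $H$ of positive degrees and a total order $\leq$ on $\Gamma$ satisfying the following conditions, where for $\gamma\in\Gamma$ we let $H^{<\gamma}$ denote the subalgebra of $H$ generated by $\{z_\delta \mid \delta\in\Gamma,\ \delta<\gamma\}$. (1) For every index $\gamma\in\Gamma$, $$\Delta_H(z_\gamma)\in 1\otimes z_\gamma+z_\gamma\otimes 1+\bigoplus_{i,j>0,\ i+j=\deg(z_\gamma)}(H^{<\gamma})_i\otimes(H^{<\gamma})_j.$$ (2) For every pair of indexes $\gamma,\delta\in\Gamma$ with $\delta<\gamma$, $$z_\gamma z_\delta-z_\delta z_\gamma\in (H^{<\gamma})_{\deg(z_\gamma z_\delta)}.$$ (3) The set $\{z_{\gamma_1}\cdots z_{\gamma_n}\mid n\geq 0,\ \gamma_1,\ldots,\gamma_n\in\Gamma,\ \gamma_1\leq\cdots\leq\gamma_n\}$ is a basis of $H$. Moreover, the Gelfand-Kirillov dimension $\mathrm{GKdim}\,H$ is finite if and only if $\Gamma$ is finite, and in this case $\mathrm{GKdim}\,H=\#(\Gamma)$.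
   Context: All vector spaces, algebras, coalgebras and tensor products are over $k$; algebras are associative and unital. A graded Hopf algebra is a Hopf algebra $H$ equipped with a grading $H=\bigoplus_{n\geq 0}H_n$ such that $H$ is simultaneously a graded algebra and a graded coalgebra, and the antipode preserves the grading. It is connected if $H_0$ is one-dimensional (i.e. $H_0=k$). $\Delta_H$ is the comultiplication of $H$. For a homogeneous subalgebra $B$ of $H$, $B_i=B\cap H_i$. The degree of a homogeneous product $z_\gamma z_\delta$ is understood as $\deg(z_\gamma)+\deg(z_\delta)$. *)

theory Defs
  imports "HOL-Library.Poly_Mapping" "HOL-Library.Extended_Real" "HOL-Library.Liminf_Limsup"
begin

text \<open>
  The scalar action is an argument of the constructions below, so tensor products cannot be
  quotient types. A tensor is therefore represented by a formal linear combination of pairs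
  (a representative in the free vector space on pairs), and two representatives stand for the
  same tensor iff they differ by an element of the span of the bilinearity relations. The
  threefold tensor product is treated in the same way, with triples.
\<close>

definition fscale :: "'k::field \<Rightarrow> ('a \<Rightarrow>\<^sub>0 'k) \<Rightarrow> ('a \<Rightarrow>\<^sub>0 'k)" where
  "fscale c p = Poly_Mapping.map ((*) c) p"

lemma lookup_fscale: "Poly_Mapping.lookup (fscale c p) x = c * Poly_Mapping.lookup p x"
  by (simp add: fscale_def Poly_Mapping.map.rep_eq when_def)

lemma vector_space_fscale: "vector_space (fscale :: 'k::field \<Rightarrow> ('a \<Rightarrow>\<^sub>0 'k) \<Rightarrow> _)"
  by unfold_locales
     (auto intro!: poly_mapping_eqI simp: lookup_fscale lookup_add algebra_simps)

definition free_lift ::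
    "('k::field \<Rightarrow> 'v \<Rightarrow> 'v) \<Rightarrow> ('a \<Rightarrow> 'v) \<Rightarrow> ('a \<Rightarrow>\<^sub>0 'k) \<Rightarrow> 'v::ab_group_add" where
  "free_lift s f p = (\<Sum>x\<in>Poly_Mapping.keys p. s (Poly_Mapping.lookup p x) (f x))"

definition pure2 :: "'h \<Rightarrow> 'h \<Rightarrow> ('h \<times> 'h \<Rightarrow>\<^sub>0 'k::field)" where
  "pure2 x y = Poly_Mapping.single (x, y) 1"

definition pure3 :: "'h \<Rightarrow> 'h \<Rightarrow> 'h \<Rightarrow> ('h \<times> 'h \<times> 'h \<Rightarrow>\<^sub>0 'k::field)" where
  "pure3 x y w = Poly_Mapping.single (x, y, w) 1"

definition bilinear_rels ::
    "('k::field \<Rightarrow> 'h \<Rightarrow> 'h) \<Rightarrow> ('h::ab_group_add \<times> 'h \<Rightarrow>\<^sub>0 'k) set" where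
  "bilinear_rels s = module.span fscale
     ({pure2 (x + x') y - pure2 x y - pure2 x' y | x x' y. True} \<union>
      {pure2 x (y + y') - pure2 x y - pure2 x y' | x y y'. True} \<union>
      {pure2 (s c x) y - fscale c (pure2 x y) | c x y. True} \<union>
      {pure2 x (s c y) - fscale c (pure2 x y) | c x y. True})"

definition trilinear_rels ::
    "('k::field \<Rightarrow> 'h \<Rightarrow> 'h) \<Rightarrow> ('h::ab_group_add \<times> 'h \<times> 'h \<Rightarrow>\<^sub>0 'k) set" where
  "trilinear_rels s = module.span fscale
     ({pure3 (x + x') y w - pure3 x y w - pure3 x' y w | x x' y w. True} \<union>
      {pure3 x (y + y') w - pure3 x y w - pure3 x y' w | x y y' w. True} \<union>
      {pure3 x y (w + w') - pure3 x y w - pure3 x y w' | x y w w'. True} \<union>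
      {pure3 (s c x) y w - fscale c (pure3 x y w) | c x y w. True} \<union>
      {pure3 x (s c y) w - fscale c (pure3 x y w) | c x y w. True} \<union>
      {pure3 x y (s c w) - fscale c (pure3 x y w) | c x y w. True})"

definition tensor2_eq ::
    "('k::field \<Rightarrow> 'h \<Rightarrow> 'h) \<Rightarrow> ('h::ab_group_add \<times> 'h \<Rightarrow>\<^sub>0 'k) \<Rightarrow> ('h \<times> 'h \<Rightarrow>\<^sub>0 'k) \<Rightarrow> bool" where
  "tensor2_eq s p q \<longleftrightarrow> p - q \<in> bilinear_rels s"

definition tensor3_eq ::
    "('k::field \<Rightarrow> 'h \<Rightarrow> 'h) \<Rightarrow> ('h::ab_group_add \<times> 'h \<times> 'h \<Rightarrow>\<^sub>0 'k) \<Rightarrow> ('h \<times> 'h \<times> 'h \<Rightarrow>\<^sub>0 'k) \<Rightarrow> bool" where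
  "tensor3_eq s p q \<longleftrightarrow> p - q \<in> trilinear_rels s"

text \<open>
  The representatives of tensors in the subspace spanned by all pure tensors of pairs in
  \<open>P\<close>. For \<open>P = A \<times> B\<close> with subspaces \<open>A\<close>, \<open>B\<close> this is the tensor product of \<open>A\<close> and \<open>B\<close> inside
  that of the whole space with itself (a subspace, as the scalars form a field); for a union of
  such products it is the sum of the corresponding subspaces.
\<close>

definition tensor2_span ::
    "('k::field \<Rightarrow> 'h \<Rightarrow> 'h) \<Rightarrow> ('h::ab_group_add \<times> 'h) set \<Rightarrow> ('h \<times> 'h \<Rightarrow>\<^sub>0 'k) set" where
  "tensor2_span s P =
     {p. \<exists>q \<in> module.span fscale {pure2 x y | x y. (x, y) \<in> P}. tensor2_eq s p q}"

definition tensor2_mult ::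
    "('h::ring_1 \<times> 'h \<Rightarrow>\<^sub>0 'k::field) \<Rightarrow> ('h \<times> 'h \<Rightarrow>\<^sub>0 'k) \<Rightarrow> ('h \<times> 'h \<Rightarrow>\<^sub>0 'k)" where
  "tensor2_mult p q =
     free_lift fscale (\<lambda>(a, b). free_lift fscale (\<lambda>(c, d). pure2 (a * c) (b * d)) q) p"

locale k_algebra = vector_space scale
  for scale :: "'k::field \<Rightarrow> 'h::ring_1 \<Rightarrow> 'h" +
  assumes scale_mult_left: "scale c x * y = scale c (x * y)"
    and scale_mult_right: "x * scale c y = scale c (x * y)"

text \<open>
  In \<open>coassoc\<close>, the two sides are the images of \<open>comult x\<close> under \<open>comult \<otimes> id\<close> and
  \<open>id \<otimes> comult\<close>; in \<open>counit_left\<close>, \<open>counit_right\<close>, \<open>antipode_left\<close>, \<open>antipode_right\<close> the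
  argument of \<open>free_lift\<close> is the map applied to the pure tensor of \<open>a\<close> and \<open>b\<close>.
\<close>

locale hopf_algebra = k_algebra scale
  for scale :: "'k::field \<Rightarrow> 'h::ring_1 \<Rightarrow> 'h" +
  fixes comult :: "'h \<Rightarrow> ('h \<times> 'h \<Rightarrow>\<^sub>0 'k)"
    and counit :: "'h \<Rightarrow> 'k"
    and antipode :: "'h \<Rightarrow> 'h"
  assumes comult_add: "tensor2_eq scale (comult (x + y)) (comult x + comult y)"
    and comult_scale: "tensor2_eq scale (comult (scale c x)) (fscale c (comult x))"
    and counit_linear: "Vector_Spaces.linear scale (*) counit"
    and coassoc: "tensor3_eq scale
          (free_lift fscale
            (\<lambda>(a, b). free_lift fscale (\<lambda>(c, d). pure3 c d b) (comult a)) (comult x))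
          (free_lift fscale
            (\<lambda>(a, b). free_lift fscale (\<lambda>(c, d). pure3 a c d) (comult b)) (comult x))"
    and counit_left: "free_lift scale (\<lambda>(a, b). scale (counit a) b) (comult x) = x"
    and counit_right: "free_lift scale (\<lambda>(a, b). scale (counit b) a) (comult x) = x"
    and comult_one: "tensor2_eq scale (comult 1) (pure2 1 1)"
    and comult_mult: "tensor2_eq scale (comult (x * y)) (tensor2_mult (comult x) (comult y))"
    and counit_one: "counit 1 = 1"
    and counit_mult: "counit (x * y) = counit x * counit y"
    and antipode_linear: "Vector_Spaces.linear scale scale antipode"
    and antipode_left: "free_lift scale (\<lambda>(a, b). antipode a * b) (comult x) = scale (counit x) 1"
    and antipode_right: "free_lift scale (\<lambda>(a, b). a * antipode b) (comult x) = scale (counit x) 1"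

locale graded_hopf_algebra = hopf_algebra scale comult counit antipode
  for scale :: "'k::field \<Rightarrow> 'h::ring_1 \<Rightarrow> 'h"
    and comult :: "'h \<Rightarrow> ('h \<times> 'h \<Rightarrow>\<^sub>0 'k)"
    and counit :: "'h \<Rightarrow> 'k"
    and antipode :: "'h \<Rightarrow> 'h" +
  fixes gr :: "nat \<Rightarrow> 'h set"
  assumes gr_subspace: "subspace (gr n)"
    and gr_direct_sum:
      "\<exists>!f :: nat \<Rightarrow> 'h. (\<forall>n. f n \<in> gr n) \<and> finite {n. f n \<noteq> 0} \<and> x = (\<Sum>n | f n \<noteq> 0. f n)"
    and gr_one: "1 \<in> gr 0"
    and gr_mult: "x \<in> gr m \<Longrightarrow> y \<in> gr n \<Longrightarrow> x * y \<in> gr (m + n)"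
    and gr_comult: "x \<in> gr n \<Longrightarrow> comult x \<in> tensor2_span scale (\<Union>i\<le>n. gr i \<times> gr (n - i))"
    and gr_counit: "x \<in> gr n \<Longrightarrow> n > 0 \<Longrightarrow> counit x = 0"
    and gr_antipode: "x \<in> gr n \<Longrightarrow> antipode x \<in> gr n"

locale connected_graded_hopf_algebra = graded_hopf_algebra scale comult counit antipode gr
  for scale :: "'k::field \<Rightarrow> 'h::ring_1 \<Rightarrow> 'h"
    and comult :: "'h \<Rightarrow> ('h \<times> 'h \<Rightarrow>\<^sub>0 'k)"
    and counit :: "'h \<Rightarrow> 'k"
    and antipode :: "'h \<Rightarrow> 'h"
    and gr :: "nat \<Rightarrow> 'h set" +
  assumes connected: "dim (gr 0) = 1"

text \<open>Meaningful for nonzero homogeneous elements only.\<close>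

definition hdeg :: "(nat \<Rightarrow> 'h set) \<Rightarrow> 'h \<Rightarrow> nat" where
  "hdeg gr x = (THE n. x \<in> gr n)"

definition is_subalgebra :: "('k::field \<Rightarrow> 'h \<Rightarrow> 'h) \<Rightarrow> 'h::ring_1 set \<Rightarrow> bool" where
  "is_subalgebra s A \<longleftrightarrow> module.subspace s A \<and> 1 \<in> A \<and> (\<forall>x\<in>A. \<forall>y\<in>A. x * y \<in> A)"

definition generated_subalgebra :: "('k::field \<Rightarrow> 'h \<Rightarrow> 'h) \<Rightarrow> 'h::ring_1 set \<Rightarrow> 'h set" where
  "generated_subalgebra s X = is_subalgebra s hull X"

definition subalgebra_below ::
    "('k::field \<Rightarrow> 'h \<Rightarrow> 'h) \<Rightarrow> 'i set \<Rightarrow> 'i rel \<Rightarrow> ('i \<Rightarrow> 'h) \<Rightarrow> 'i \<Rightarrow> 'h::ring_1 set" where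
  "subalgebra_below s I r z \<gamma> = generated_subalgebra s (z ` {\<delta> \<in> I. (\<delta>, \<gamma>) \<in> r \<and> \<delta> \<noteq> \<gamma>})"

definition is_basis :: "('k::field \<Rightarrow> 'h \<Rightarrow> 'h) \<Rightarrow> 'h::ab_group_add set \<Rightarrow> bool" where
  "is_basis s B \<longleftrightarrow> \<not> module.dependent s B \<and> module.span s B = UNIV"

definition ordered_words :: "'i set \<Rightarrow> 'i rel \<Rightarrow> 'i list set" where
  "ordered_words I r = {w. set w \<subseteq> I \<and> sorted_wrt (\<lambda>a b. (a, b) \<in> r) w}"

text \<open>
  The supremum over all finite-dimensional subspaces \<open>V\<close> of the limes superior of
  \<open>log\<^bsub>n\<^esub> dim (V\<^sup>0 + V\<^sup>1 + \<dots> + V\<^sup>n)\<close>.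
\<close>

definition GKdim :: "('k::field \<Rightarrow> 'h \<Rightarrow> 'h::ring_1) \<Rightarrow> ereal" where
  "GKdim s = (SUP V \<in> {module.span s B | B. finite B}.
     limsup (\<lambda>n. ereal (log (real n)
       (real (vector_space.dim s {prod_list xs | xs. set xs \<subseteq> V \<and> length xs \<le> n})))))"

end

theory Submission
  imports Defs "HOL-Library.Multiset" "HOL-Library.FuncSet"
begin

text \<open>
  The proof separates the construction of the generators from the deduction of their properties.

  The generators come from a nested system of graded subbialgebras. For a graded subbialgebra \<open>U\<close>
  and \<open>n > 0\<close> let \<open>R\<^sub>n(U)\<close> be the least subalgebra that contains the elements of \<open>U\<close> of degree
  below \<open>n\<close>, the commutators of elements of \<open>U\<close> of degree \<open>n\<close>, and its own commutators with these
  elements (\<open>ad_hull\<close>). An element \<open>v\<close> of \<open>U\<close> of degree \<open>n\<close> is primitive modulo tensors of elements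
  of \<open>U\<close> of degree below \<open>n\<close>, so \<open>\<Delta>[v, b] = [\<Delta> v, \<Delta> b]\<close> shows that \<open>R\<^sub>n(U)\<close> is a subbialgebra
  (\<open>subbialgebra_ad_hull\<close>). All commutators involved have degree above \<open>n\<close>, so in degree \<open>n\<close> it is
  still generated by lower degrees (\<open>ad_hull_gr\<close>). Start with the chain consisting of \<open>H\<close> alone,
  and in step \<open>n\<close> insert \<open>R\<^sub>n(U)\<close> below each member \<open>U\<close>. Every step yields a finite chain
  (\<open>levels_chain\<close>) that is compatible with the earlier ones (\<open>nodes_linear\<close>). For each member \<open>U\<close>
  in step \<open>n\<close>, a well-ordered basis of a complement of \<open>R\<^sub>n(U)\<close> in \<open>U\<close> in degree \<open>n\<close> enters the
  family of generators. The generators in \<open>R\<^sub>n(U)\<close> precede this basis, and they generate \<open>R\<^sub>n(U)\<close>,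
  by induction on the degree (\<open>levels_generated\<close>). The reduced coproduct of a basis element has its
  factors in \<open>U\<close> in degrees below \<open>n\<close>, hence in \<open>R\<^sub>n(U)\<close>, and its commutators with earlier
  generators lie in \<open>R\<^sub>n(U)\<close> by construction. This gives the conditions (1) and (2).

  Condition (3) follows from (1) and (2) together with the facts that no generator lies in the
  subalgebra of the smaller ones and that the order is well-founded in bounded degree. By (2), any
  word can be sorted at the price of words with smaller letters, and this terminates
  (\<open>word_in_span\<close>). By (1), a linear form that vanishes on the subalgebra generated by the elements
  below \<open>\<gamma>\<close> and takes the value 1 at \<open>\<gamma>\<close> yields a derivation that kills all smaller generators and
  sends \<open>\<gamma>\<close> to 1 (\<open>derivation_at_generator\<close>). Differentiating a linear relation among ordered words
  by its largest letter gives a shorter one, nontrivial in characteristic zero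
  (\<open>ordered_words_independent\<close>).

  For the Gelfand-Kirillov dimension, the \<open>n\<close>-th power of the span of \<open>m\<close> generators contains on the
  order of \<open>n^m\<close> ordered words. Conversely, if there are \<open>m\<close> generators in all, the \<open>n\<close>-th power of a
  finite-dimensional subspace has degrees bounded by a multiple of \<open>n\<close>, which leaves at most on the
  order of \<open>n^m\<close> ordered words, as generators have positive degree.
\<close>

section \<open>Linear maps out of a free vector space, and tensors\<close>

interpretation F: vector_space "fscale :: 'k::field \<Rightarrow> ('a \<Rightarrow>\<^sub>0 'k) \<Rightarrow> _"
  by (rule vector_space_fscale)

context vector_space
begin

lemma free_lift_superset:
  "finite A \<Longrightarrow> Poly_Mapping.keys p \<subseteq> A \<Longrightarrow>
     free_lift scale f p = (\<Sum>x\<in>A. scale (Poly_Mapping.lookup p x) (f x))"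
  unfolding free_lift_def by (rule sum.mono_neutral_left) (auto simp: in_keys_iff)

lemma free_lift_add: "free_lift scale f (p + q) = free_lift scale f p + free_lift scale f q"
proof -
  let ?A = "Poly_Mapping.keys p \<union> Poly_Mapping.keys q"
  have "Poly_Mapping.keys (p + q) \<subseteq> ?A" by (rule Poly_Mapping.keys_add)
  then show ?thesis
    by (simp add: free_lift_superset[of ?A] lookup_add scale_left_distrib sum.distrib)
qed

lemma free_lift_fscale: "free_lift scale f (fscale c p) = scale c (free_lift scale f p)"
proof -
  have "Poly_Mapping.keys (fscale c p) \<subseteq> Poly_Mapping.keys p"
    by (auto simp: in_keys_iff lookup_fscale)
  then show ?thesis
    by (simp add: free_lift_superset[of "Poly_Mapping.keys p"] lookup_fscale scale_sum_right)
qed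

lemma linear_free_lift: "Vector_Spaces.linear fscale scale (free_lift scale f)"
  by (intro Vector_Spaces.linear_iff[THEN iffD2] conjI allI vector_space_axioms
      vector_space_fscale free_lift_add free_lift_fscale)

lemma free_lift_diff: "free_lift scale f (p - q) = free_lift scale f p - free_lift scale f q"
  using free_lift_add[of f "p - q" q] by simp

lemma free_lift_single: "free_lift scale f (Poly_Mapping.single x 1) = f x"
  by (simp add: free_lift_def)

lemma free_lift_pure2: "free_lift scale f (pure2 x y) = f (x, y)"
  by (simp add: pure2_def free_lift_single)

lemma free_lift_fun_add:
  "free_lift scale (\<lambda>x. f x + g x) p = free_lift scale f p + free_lift scale g p"
  by (simp add: free_lift_def scale_right_distrib sum.distrib)

lemma free_lift_fun_diff:
  "free_lift scale (\<lambda>x. f x - g x) p = free_lift scale f p - free_lift scale g p"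
  by (simp add: free_lift_def scale_right_diff_distrib sum_subtractf)

lemma free_lift_fun_scale:
  "free_lift scale (\<lambda>x. scale c (f x)) p = scale c (free_lift scale f p)"
  by (simp add: free_lift_def scale_sum_right mult.commute)

lemma free_lift_in_subspace:
  "subspace N \<Longrightarrow> (\<And>x. f x \<in> N) \<Longrightarrow> free_lift scale f p \<in> N"
  unfolding free_lift_def by (intro subspace_sum subspace_scale)

text \<open>
  The universal property of the tensor product: a map that is bilinear modulo \<open>N\<close> sends the
  relations into \<open>N\<close>. With \<open>N = {0}\<close> this gives maps out of the tensor product, and with
  \<open>N\<close> a space of relations maps between tensor products.
\<close>

lemma free_lift_bilinear_rels:
  assumes N: "subspace N" and p: "p \<in> bilinear_rels s"
    and "\<And>x x' y. f (x + x', y) - f (x, y) - f (x', y) \<in> N"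
    and "\<And>x y y'. f (x, y + y') - f (x, y) - f (x, y') \<in> N"
    and "\<And>c x y. f (s c x, y) - scale c (f (x, y)) \<in> N"
    and "\<And>c x y. f (x, s c y) - scale c (f (x, y)) \<in> N"
  shows "free_lift scale f p \<in> N"
proof -
  interpret l: Vector_Spaces.linear fscale scale "free_lift scale f"
    by (rule linear_free_lift)
  have "bilinear_rels s \<subseteq> {p. free_lift scale f p \<in> N}"
    unfolding bilinear_rels_def
    by (rule F.span_minimal)
       (auto simp: assms(3-6) free_lift_diff free_lift_pure2 free_lift_fscale
         intro!: l.subspace_vimage[unfolded vimage_def] N)
  then show ?thesis using p by blast
qed

end

lemma subspace_bilinear_rels: "F.subspace (bilinear_rels s)"
  unfolding bilinear_rels_def by (rule F.subspace_span)

lemma tensor2_eq_refl [simp]: "tensor2_eq s p p"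
  by (simp add: tensor2_eq_def F.subspace_0 subspace_bilinear_rels)

lemma tensor2_eq_sym: "tensor2_eq s p q \<Longrightarrow> tensor2_eq s q p"
  using F.subspace_neg[OF subspace_bilinear_rels, of "p - q" s] by (simp add: tensor2_eq_def)

lemma tensor2_eq_trans: "tensor2_eq s p q \<Longrightarrow> tensor2_eq s q r \<Longrightarrow> tensor2_eq s p r"
  using F.subspace_add[OF subspace_bilinear_rels, of "p - q" s "q - r"]
  by (simp add: tensor2_eq_def)

lemma tensor2_eq_add:
  "tensor2_eq s p q \<Longrightarrow> tensor2_eq s p' q' \<Longrightarrow> tensor2_eq s (p + p') (q + q')"
  using F.subspace_add[OF subspace_bilinear_rels, of "p - q" s "p' - q'"]
  by (simp add: tensor2_eq_def algebra_simps)

lemma tensor2_eq_diff: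
  "tensor2_eq s p q \<Longrightarrow> tensor2_eq s p' q' \<Longrightarrow> tensor2_eq s (p - p') (q - q')"
  using F.subspace_diff[OF subspace_bilinear_rels, of "p - q" s "p' - q'"]
  unfolding tensor2_eq_def by (simp add: algebra_simps)

lemma
  shows tensor2_eq_pure_add_left: "tensor2_eq s (pure2 (x + x') y) (pure2 x y + pure2 x' y)"
    and tensor2_eq_pure_add_right: "tensor2_eq s (pure2 x (y + y')) (pure2 x y + pure2 x y')"
    and tensor2_eq_pure_scale_left: "tensor2_eq s (pure2 (s c x) y) (fscale c (pure2 x y))"
    and tensor2_eq_pure_scale_right: "tensor2_eq s (pure2 x (s c y)) (fscale c (pure2 x y))"
  unfolding tensor2_eq_def bilinear_rels_def diff_diff_eq[symmetric]
  by (rule F.span_base; blast)+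

lemma tensor2_eq_pure_diff_left: "tensor2_eq s (pure2 (x - x') y) (pure2 x y - pure2 x' y)"
  using tensor2_eq_diff[OF tensor2_eq_pure_add_left[of s "x - x'" x' y] tensor2_eq_refl[of s "pure2 x' y"]]
  by (simp add: tensor2_eq_sym)

lemma tensor2_eq_pure_diff_right: "tensor2_eq s (pure2 x (y - y')) (pure2 x y - pure2 x y')"
  using tensor2_eq_diff[OF tensor2_eq_pure_add_right[of s x "y - y'" y'] tensor2_eq_refl[of s "pure2 x y'"]]
  by (simp add: tensor2_eq_sym)

lemma tensor2_eq_pure_zero_left: "tensor2_eq s (pure2 0 y) 0"
  using tensor2_eq_pure_diff_left[of s 0 0 y] by simp

lemma tensor2_eq_pure_zero_right: "tensor2_eq s (pure2 x 0) 0"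
  using tensor2_eq_pure_diff_right[of s x 0 0] by simp

lemma tensor2_span_eq:
  "tensor2_span s P = F.span ({pure2 x y | x y. (x, y) \<in> P} \<union> bilinear_rels s)"
  (is "?L = F.span (?X \<union> ?R)")
proof -
  have R: "F.span ?R = ?R"
    using subspace_bilinear_rels by (rule F.span_eq_iff[THEN iffD2])
  show ?thesis
  proof (intro subset_antisym subsetI)
    fix p assume "p \<in> ?L"
    then obtain q where "q \<in> F.span ?X" "p - q \<in> ?R"
      by (auto simp: tensor2_span_def tensor2_eq_def)
    then show "p \<in> F.span (?X \<union> ?R)"
      using F.span_add[of q "?X \<union> ?R" "p - q"] F.span_mono[of ?X "?X \<union> ?R"]
        F.span_base[of "p - q" "?X \<union> ?R"] by auto
  next
    fix p assume "p \<in> F.span (?X \<union> ?R)"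
    then obtain q r where "q \<in> F.span ?X" "r \<in> ?R" "p = q + r"
      unfolding F.span_Un R by blast
    then show "p \<in> ?L"
      by (auto simp: tensor2_span_def tensor2_eq_def intro!: bexI[of _ q])
  qed
qed

lemma subspace_tensor2_span: "F.subspace (tensor2_span s P)"
  unfolding tensor2_span_eq by (rule F.subspace_span)

lemma pure2_in_tensor2_span: "(x, y) \<in> P \<Longrightarrow> pure2 x y \<in> tensor2_span s P"
  unfolding tensor2_span_eq by (rule F.span_base) blast

lemma rels_subset_tensor2_span: "bilinear_rels s \<subseteq> tensor2_span s P"
  unfolding tensor2_span_eq using F.span_superset by blast

lemma tensor2_span_minimal:
  "F.subspace T \<Longrightarrow> (\<And>x y. (x, y) \<in> P \<Longrightarrow> pure2 x y \<in> T) \<Longrightarrow> bilinear_rels s \<subseteq> T \<Longrightarrow>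
     tensor2_span s P \<subseteq> T"
  unfolding tensor2_span_eq by (rule F.span_minimal) auto

lemma tensor2_span_mono: "P \<subseteq> Q \<Longrightarrow> tensor2_span s P \<subseteq> tensor2_span s Q"
  unfolding tensor2_span_eq by (rule F.span_mono) blast

lemma tensor2_span_cong:
  assumes "tensor2_eq s p q" "q \<in> tensor2_span s P"
  shows "p \<in> tensor2_span s P"
  using F.subspace_add[OF subspace_tensor2_span assms(2), of "p - q"] assms(1)
    rels_subset_tensor2_span unfolding tensor2_eq_def by fastforce

lemma tensor2_span_zero: "0 \<in> tensor2_span s P"
  by (rule F.subspace_0[OF subspace_tensor2_span])

lemma tensor2_span_add:
  "p \<in> tensor2_span s P \<Longrightarrow> q \<in> tensor2_span s P \<Longrightarrow> p + q \<in> tensor2_span s P"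
  by (rule F.subspace_add[OF subspace_tensor2_span])

lemma tensor2_span_diff:
  "p \<in> tensor2_span s P \<Longrightarrow> q \<in> tensor2_span s P \<Longrightarrow> p - q \<in> tensor2_span s P"
  by (rule F.subspace_diff[OF subspace_tensor2_span])

text \<open>
  Linear maps respecting the relations have subspaces as preimages of subspaces, so that a
  property of the image need only be checked on pure tensors.
\<close>

lemma tensor2_span_linear_image:
  assumes g: "Vector_Spaces.linear fscale t g"
    and p: "p \<in> tensor2_span s P"
    and N: "module.subspace t N"
    and pure: "\<And>x y. (x, y) \<in> P \<Longrightarrow> g (pure2 x y) \<in> N"
    and rels: "\<And>r. r \<in> bilinear_rels s \<Longrightarrow> g r \<in> N"
  shows "g p \<in> N"
proof -
  interpret Vector_Spaces.linear fscale t g by (rule g)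
  have "tensor2_span s P \<subseteq> {p. g p \<in> N}"
    using pure rels subspace_vimage[OF N, unfolded vimage_def]
    by (intro tensor2_span_minimal) auto
  with p show ?thesis by blast
qed

lemma
  shows tensor2_mult_add_left: "tensor2_mult (p + p') q = tensor2_mult p q + tensor2_mult p' q"
    and tensor2_mult_diff_left: "tensor2_mult (p - p') q = tensor2_mult p q - tensor2_mult p' q"
    and tensor2_mult_fscale_left: "tensor2_mult (fscale c p) q = fscale c (tensor2_mult p q)"
  unfolding tensor2_mult_def by (rule F.free_lift_add F.free_lift_diff F.free_lift_fscale)+

lemma
  shows tensor2_mult_add_right: "tensor2_mult p (q + q') = tensor2_mult p q + tensor2_mult p q'"
    and tensor2_mult_diff_right: "tensor2_mult p (q - q') = tensor2_mult p q - tensor2_mult p q'"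
    and tensor2_mult_fscale_right: "tensor2_mult p (fscale c q) = fscale c (tensor2_mult p q)"
  unfolding tensor2_mult_def
  by (simp_all add: F.free_lift_add F.free_lift_diff F.free_lift_fscale case_prod_unfold
      F.free_lift_fun_add F.free_lift_fun_diff F.free_lift_fun_scale)

lemma tensor2_mult_pure2: "tensor2_mult (pure2 a b) (pure2 c d) = pure2 (a * c) (b * d)"
  by (simp add: tensor2_mult_def F.free_lift_pure2)

lemma linear_tensor2_mult_left:
  "Vector_Spaces.linear fscale fscale (\<lambda>p. tensor2_mult p q)"
  by (intro Vector_Spaces.linear_iff[THEN iffD2] conjI allI vector_space_fscale
      tensor2_mult_add_left tensor2_mult_fscale_left)

lemma linear_tensor2_mult_right: "Vector_Spaces.linear fscale fscale (tensor2_mult p)"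
  by (intro Vector_Spaces.linear_iff[THEN iffD2] conjI allI vector_space_fscale
      tensor2_mult_add_right tensor2_mult_fscale_right)

context k_algebra
begin

lemma tensor2_mult_rels_left:
  assumes "p \<in> bilinear_rels scale"
  shows "tensor2_mult p q \<in> bilinear_rels scale"
  unfolding tensor2_mult_def
proof (rule F.free_lift_bilinear_rels[OF subspace_bilinear_rels assms]; simp;
    (subst F.free_lift_fun_scale[symmetric])?; (subst F.free_lift_fun_diff[symmetric])+)
qed (rule F.free_lift_in_subspace[OF subspace_bilinear_rels];
    auto simp: distrib_right scale_mult_left tensor2_eq_def[symmetric] diff_diff_eq
      intro!: tensor2_eq_pure_add_left tensor2_eq_pure_add_right
      tensor2_eq_pure_scale_left tensor2_eq_pure_scale_right)+

lemma tensor2_mult_rels_right: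
  assumes "q \<in> bilinear_rels scale"
  shows "tensor2_mult p q \<in> bilinear_rels scale"
  unfolding tensor2_mult_def
  by (rule F.free_lift_in_subspace[OF subspace_bilinear_rels], clarsimp,
      rule F.free_lift_bilinear_rels[OF subspace_bilinear_rels assms])
     (auto simp: distrib_left scale_mult_right tensor2_eq_def[symmetric] diff_diff_eq
      intro!: tensor2_eq_pure_add_left tensor2_eq_pure_add_right
      tensor2_eq_pure_scale_left tensor2_eq_pure_scale_right)

lemma tensor2_mult_in_span:
  assumes p: "p \<in> tensor2_span scale P" and q: "q \<in> tensor2_span scale Q"
    and PQ: "\<And>a b c d. (a, b) \<in> P \<Longrightarrow> (c, d) \<in> Q \<Longrightarrow> (a * c, b * d) \<in> R"
  shows "tensor2_mult p q \<in> tensor2_span scale R"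
proof (rule tensor2_span_linear_image[OF linear_tensor2_mult_left p subspace_tensor2_span])
  show "tensor2_mult (pure2 a b) q \<in> tensor2_span scale R" if "(a, b) \<in> P" for a b
  proof (rule tensor2_span_linear_image[OF linear_tensor2_mult_right q subspace_tensor2_span])
    show "tensor2_mult (pure2 a b) (pure2 c d) \<in> tensor2_span scale R" if "(c, d) \<in> Q" for c d
      unfolding tensor2_mult_pure2 by (intro pure2_in_tensor2_span PQ that \<open>(a, b) \<in> P\<close>)
  qed (use tensor2_mult_rels_right rels_subset_tensor2_span in blast)
qed (use tensor2_mult_rels_left rels_subset_tensor2_span in blast)

end

section \<open>Generated subalgebras and homogeneous components\<close>

context k_algebra
begin

abbreviation Alg :: "'h set \<Rightarrow> 'h set" where "Alg \<equiv> generated_subalgebra scale"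

lemma subalgebra_Alg: "is_subalgebra scale (Alg X)"
  unfolding generated_subalgebra_def
  by (rule hull_in) (auto simp: is_subalgebra_def subspace_def)

lemma subspace_Alg: "subspace (Alg X)"
  using subalgebra_Alg by (simp add: is_subalgebra_def)

lemma Alg_one: "1 \<in> Alg X"
  using subalgebra_Alg by (simp add: is_subalgebra_def)

lemma Alg_mult: "x \<in> Alg X \<Longrightarrow> y \<in> Alg X \<Longrightarrow> x * y \<in> Alg X"
  using subalgebra_Alg by (simp add: is_subalgebra_def)

lemma Alg_base: "x \<in> X \<Longrightarrow> x \<in> Alg X"
  unfolding generated_subalgebra_def by (rule hull_inc)

lemma Alg_minimal: "X \<subseteq> A \<Longrightarrow> is_subalgebra scale A \<Longrightarrow> Alg X \<subseteq> A"
  unfolding generated_subalgebra_def by (rule hull_minimal)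

lemma Alg_least: "X \<subseteq> Alg Y \<Longrightarrow> Alg X \<subseteq> Alg Y"
  by (rule Alg_minimal[OF _ subalgebra_Alg])

lemma Alg_mono: "X \<subseteq> Y \<Longrightarrow> Alg X \<subseteq> Alg Y"
  by (rule Alg_least) (auto intro: Alg_base)

lemma Alg_induct [consumes 1, case_names base one mult add scale]:
  assumes "x \<in> Alg X" and "\<And>x. x \<in> X \<Longrightarrow> P x" and "P 1"
    and "\<And>x y. P x \<Longrightarrow> P y \<Longrightarrow> P (x * y)" and "\<And>x y. P x \<Longrightarrow> P y \<Longrightarrow> P (x + y)"
    and "\<And>c x. P x \<Longrightarrow> P (scale c x)"
  shows "P x"
proof -
  have "P 0" using assms(6)[OF assms(3), of 0] by simp
  then have "is_subalgebra scale (Collect P)"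
    using assms by (auto simp: is_subalgebra_def intro!: subspaceI)
  then show ?thesis using Alg_minimal[of X "Collect P"] assms(1,2) by blast
qed

end

context graded_hopf_algebra
begin

definition hcomp :: "nat \<Rightarrow> 'h \<Rightarrow> 'h" where
  "hcomp n x =
     (THE f. (\<forall>n. f n \<in> gr n) \<and> finite {n. f n \<noteq> 0} \<and> x = (\<Sum>n | f n \<noteq> 0. f n)) n"

lemma
  shows hcomp_in_gr: "hcomp n x \<in> gr n"
    and finite_hcomp: "finite {n. hcomp n x \<noteq> 0}"
    and sum_hcomp: "(\<Sum>n | hcomp n x \<noteq> 0. hcomp n x) = x"
proof -
  have eq: "(\<lambda>n. hcomp n x) =
      (THE f. (\<forall>n. f n \<in> gr n) \<and> finite {n. f n \<noteq> 0} \<and> x = (\<Sum>n | f n \<noteq> 0. f n))"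
    unfolding hcomp_def by simp
  show "hcomp n x \<in> gr n" "finite {n. hcomp n x \<noteq> 0}"
    "(\<Sum>n | hcomp n x \<noteq> 0. hcomp n x) = x"
    using theI'[OF gr_direct_sum[of x], folded eq] by auto
qed

lemma hcomp_unique:
  assumes "\<And>n. f n \<in> gr n" "finite A" "\<And>n. n \<notin> A \<Longrightarrow> f n = 0" "x = (\<Sum>n\<in>A. f n)"
  shows "hcomp n x = f n"
proof -
  have A: "{n. f n \<noteq> 0} \<subseteq> A" using assms(3) by blast
  have "x = (\<Sum>n | f n \<noteq> 0. f n)"
    unfolding assms(4) by (rule sum.mono_neutral_right[OF assms(2) A]) auto
  with assms(1) finite_subset[OF A assms(2)] show ?thesis
    unfolding hcomp_def by (subst the1_equality[OF gr_direct_sum, of f]) auto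
qed

lemma hcomp_superset:
  "finite A \<Longrightarrow> {n. hcomp n x \<noteq> 0} \<subseteq> A \<Longrightarrow> (\<Sum>n\<in>A. hcomp n x) = x"
  by (subst (2) sum_hcomp[symmetric]) (rule sum.mono_neutral_right, auto)

lemma hcomp_add: "hcomp n (x + y) = hcomp n x + hcomp n y"
proof -
  define A where "A = {n. hcomp n x \<noteq> 0} \<union> {n. hcomp n y \<noteq> 0}"
  have A: "finite A" by (simp add: A_def finite_hcomp)
  have "x + y = (\<Sum>n\<in>A. hcomp n x + hcomp n y)"
    using A by (simp add: sum.distrib hcomp_superset A_def)
  then show ?thesis
    by (intro hcomp_unique[OF _ A]) (auto simp: A_def intro: subspace_add[OF gr_subspace] hcomp_in_gr)
qed

lemma hcomp_scale: "hcomp n (scale c x) = scale c (hcomp n x)"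
proof (rule hcomp_unique[OF _ finite_hcomp[of x]])
  show "scale c x = (\<Sum>n | hcomp n x \<noteq> 0. scale c (hcomp n x))"
    by (simp add: sum_hcomp flip: scale_sum_right)
qed (auto intro: subspace_scale[OF gr_subspace] hcomp_in_gr)

lemma linear_hcomp: "Vector_Spaces.linear scale scale (hcomp n)"
  by (intro Vector_Spaces.linear_iff[THEN iffD2] conjI allI vector_space_axioms
      hcomp_add hcomp_scale)

lemma hcomp_gr: "x \<in> gr m \<Longrightarrow> hcomp n x = (if n = m then x else 0)"
  by (rule hcomp_unique[of _ "{m}"]) (auto simp: subspace_0[OF gr_subspace])

lemma hcomp_zero [simp]: "hcomp n 0 = 0"
  using hcomp_scale[of n 0 0] by simp

lemma gr_unique: "x \<in> gr m \<Longrightarrow> x \<in> gr n \<Longrightarrow> x \<noteq> 0 \<Longrightarrow> m = n"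
  by (metis hcomp_gr)

lemma hdeg_eq: "x \<in> gr n \<Longrightarrow> x \<noteq> 0 \<Longrightarrow> hdeg gr x = n"
  unfolding hdeg_def by (rule the_equality) (auto dest: gr_unique)

lemma in_subspace_if_hcomp: "subspace V \<Longrightarrow> (\<And>n. hcomp n x \<in> V) \<Longrightarrow> x \<in> V"
  by (subst sum_hcomp[symmetric]) (rule subspace_sum)

definition graded_subspace :: "'h set \<Rightarrow> bool" where
  "graded_subspace V \<longleftrightarrow> subspace V \<and> (\<forall>x\<in>V. \<forall>n. hcomp n x \<in> V)"

lemma graded_subspace_UNIV: "graded_subspace UNIV"
  by (simp add: graded_subspace_def)

definition pos_homogeneous :: "'h set" where
  "pos_homogeneous = (\<Union>i\<in>{0<..}. gr i)"

definition below :: "nat \<Rightarrow> 'h set" where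
  "below n = (\<Union>i\<in>{0<..<n}. gr i)"

lemma below_subset_pos: "below n \<subseteq> pos_homogeneous"
  by (auto simp: below_def pos_homogeneous_def)

lemma below_mono: "m \<le> n \<Longrightarrow> below m \<subseteq> below n"
  by (auto simp: below_def) (meson greaterThanLessThan_iff order_less_le_trans)

lemma below_Suc: "0 < n \<Longrightarrow> below (Suc n) = below n \<union> gr n"
  by (auto simp: below_def less_Suc_eq)

lemma gr_subset_below: "0 < i \<Longrightarrow> i < n \<Longrightarrow> gr i \<subseteq> below n"
  by (auto simp: below_def)

lemma mult_in_gr: "x \<in> gr i \<Longrightarrow> y \<in> gr j \<Longrightarrow> i + j = n \<Longrightarrow> x * y \<in> gr n"
  using gr_mult by blast

lemma commutator_in_gr: "x \<in> gr i \<Longrightarrow> y \<in> gr j \<Longrightarrow> i + j = n \<Longrightarrow> x * y - y * x \<in> gr n"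
  using mult_in_gr[of x i y j n] mult_in_gr[of y j x i n]
  by (auto intro: subspace_diff[OF gr_subspace] simp: add.commute)

text \<open>
  Words carry the sum of the degrees of their letters, so that a homogeneous element of a
  subalgebra can be written with words of its own degree only.
\<close>

inductive monomial :: "'h set \<Rightarrow> nat \<Rightarrow> 'h \<Rightarrow> bool" for X where
  monomial_one: "monomial X 0 1"
| monomial_step: "x \<in> X \<Longrightarrow> x \<in> gr i \<Longrightarrow> 0 < i \<Longrightarrow> monomial X j y \<Longrightarrow> monomial X (i + j) (x * y)"

lemma monomial_in_gr: "monomial X n y \<Longrightarrow> y \<in> gr n"
  by (induction rule: monomial.induct) (auto intro: gr_one gr_mult)

lemma monomial_in_Alg: "monomial X n y \<Longrightarrow> y \<in> Alg X"
  by (induction rule: monomial.induct) (auto intro: Alg_one Alg_mult Alg_base)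

lemma monomial_mult: "monomial X m x \<Longrightarrow> monomial X n y \<Longrightarrow> monomial X (m + n) (x * y)"
  by (induction rule: monomial.induct)
     (auto simp: mult.assoc add.assoc intro: monomial.intros)

lemma monomial_below: "monomial X n y \<Longrightarrow> n < m \<Longrightarrow> monomial (X \<inter> below m) n y"
proof (induction rule: monomial.induct)
  case (monomial_step x i j y)
  then have "x \<in> X \<inter> below m" using gr_subset_below[of i m] by auto
  with monomial_step show ?case by (auto intro: monomial.intros)
qed (rule monomial.intros)

lemma monomial_0: "monomial X n y \<Longrightarrow> n = 0 \<Longrightarrow> y = 1"
  by (induction rule: monomial.induct) auto

text \<open>Letters have positive degree, so the letters of a longer word have smaller degree than the word.\<close>

lemma monomial_cases_degree:
  assumes "monomial X n y"
  shows "y \<in> X \<inter> gr n \<or> monomial (X \<inter> below n) n y"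
  using assms
proof cases
  case (monomial_step x i j y')
  show ?thesis
  proof (cases "j = 0")
    case True
    then show ?thesis using monomial_step monomial_0[of X j y'] by simp
  next
    case False
    then have "i < n" "j < n" using monomial_step by auto
    then have "x \<in> X \<inter> below n" "monomial (X \<inter> below n) j y'"
      using monomial_step gr_subset_below[of i n] monomial_below by auto
    then show ?thesis using monomial_step by (auto intro: monomial.intros)
  qed
qed (auto intro: monomial.intros)

lemma Alg_hcomp_monomials:
  assumes X: "X \<subseteq> pos_homogeneous" and x: "x \<in> Alg X"
  shows "hcomp n x \<in> span {y. monomial X n y}"
proof -
  let ?M = "{y. \<exists>n. monomial X n y}"
  have "is_subalgebra scale (span ?M)"
    unfolding is_subalgebra_def
  proof (intro conjI ballI subspace_span)
    show "1 \<in> span ?M" by (intro span_base) (auto intro: monomial.intros)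
    fix x y assume x: "x \<in> span ?M" and y: "y \<in> span ?M"
    have "x * b \<in> span ?M" if "monomial X m b" for b m
      using x
    proof (induction rule: span_induct_alt)
      case (step c a z)
      then show ?case
        using that by (auto simp: distrib_right scale_mult_left intro!: span_add span_scale
            intro: span_base monomial_mult)
    qed (simp add: span_zero)
    with y show "x * y \<in> span ?M"
      by (induction rule: span_induct_alt)
         (auto simp: distrib_left scale_mult_right span_zero intro!: span_add span_scale)
  qed
  moreover have "X \<subseteq> span ?M"
  proof
    fix x assume "x \<in> X"
    with X obtain i where "x \<in> gr i" "0 < i" by (auto simp: pos_homogeneous_def)
    then have "monomial X (i + 0) (x * 1)"
      using \<open>x \<in> X\<close> by (intro monomial.intros)
    then show "x \<in> span ?M" by (auto intro: span_base)
  qed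
  ultimately have "x \<in> span ?M" using Alg_minimal x by blast
  then show ?thesis
    by (induction rule: span_induct_alt)
       (auto simp: span_zero hcomp_add hcomp_scale hcomp_gr[OF monomial_in_gr]
         intro!: span_add span_scale intro: span_base)
qed

lemma graded_Alg:
  assumes "X \<subseteq> pos_homogeneous"
  shows "graded_subspace (Alg X)"
proof -
  have "span {y. monomial X n y} \<subseteq> Alg X" for n
    by (intro span_minimal subspace_Alg) (auto intro: monomial_in_Alg)
  then show ?thesis
    using Alg_hcomp_monomials[OF assms] by (auto simp: graded_subspace_def subspace_Alg)
qed

lemma Alg_gr_monomials:
  "X \<subseteq> pos_homogeneous \<Longrightarrow> x \<in> Alg X \<Longrightarrow> x \<in> gr n \<Longrightarrow> x \<in> span {y. monomial X n y}"
  using Alg_hcomp_monomials[of X x n] by (simp add: hcomp_gr)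

lemma Alg_gr_below:
  assumes "X \<subseteq> pos_homogeneous" "x \<in> Alg X" "x \<in> gr n" "n < m"
  shows "x \<in> Alg (X \<inter> below m)"
proof -
  have "span {y. monomial X n y} \<subseteq> Alg (X \<inter> below m)"
    by (intro span_minimal subspace_Alg)
       (use assms(4) in \<open>auto intro: monomial_in_Alg monomial_below\<close>)
  then show ?thesis using Alg_gr_monomials assms by blast
qed

text \<open>
  The dichotomy for words passes to linear combinations: up to letters of its own degree, a
  homogeneous element is generated in smaller degrees.
\<close>

lemma Alg_gr_decompose:
  assumes "X \<subseteq> pos_homogeneous" "x \<in> Alg X" "x \<in> gr n"
  obtains a b where "a \<in> span (X \<inter> gr n)" "b \<in> Alg (X \<inter> below n) \<inter> gr n" "x = a + b"
proof -
  have "{y. monomial X n y} \<subseteq> (X \<inter> gr n) \<union> (Alg (X \<inter> below n) \<inter> gr n)"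
    using monomial_cases_degree monomial_in_Alg monomial_in_gr by blast
  then have "x \<in> span ((X \<inter> gr n) \<union> (Alg (X \<inter> below n) \<inter> gr n))"
    using Alg_gr_monomials[OF assms] span_mono by blast
  moreover have "span (Alg (X \<inter> below n) \<inter> gr n) = Alg (X \<inter> below n) \<inter> gr n"
    by (intro span_eq_iff[THEN iffD2] subspace_inter subspace_Alg gr_subspace)
  ultimately show thesis using that unfolding span_Un by blast
qed

lemma Alg_gr_no_letter:
  assumes "X \<subseteq> pos_homogeneous" "x \<in> Alg X" "x \<in> gr n" "X \<inter> gr n \<subseteq> {0}"
  shows "x \<in> Alg (X \<inter> below n)"
proof -
  from assms obtain a b where "a \<in> span (X \<inter> gr n)" "b \<in> Alg (X \<inter> below n)" "x = a + b"
    using Alg_gr_decompose[OF assms(1-3)] by blast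
  moreover have "span (X \<inter> gr n) \<subseteq> {0}"
    using assms(4) by (intro span_minimal) auto
  ultimately show ?thesis by auto
qed

end

context connected_graded_hopf_algebra
begin

lemma gr_0_scalar:
  assumes "x \<in> gr 0"
  obtains c where "x = scale c 1"
proof -
  obtain B where "B \<subseteq> gr 0" and B: "gr 0 \<subseteq> span B" "card B = 1"
    using basis_exists[of "gr 0"] connected by metis
  then obtain b where "B = {b}" by (auto simp: card_1_singleton_iff)
  then have "gr 0 \<subseteq> range (\<lambda>k. scale k b)" using B(1) by (simp add: span_singleton)
  then obtain c d where c: "1 = scale c b" and d: "x = scale d b"
    using gr_one assms by blast
  have "c \<noteq> 0" using c by auto
  then have "scale (d / c) (scale c b) = x" using d by simp
  then show thesis using that[of "d / c"] c by simp
qed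

lemma counit_hcomp: "scale (counit x) 1 = hcomp 0 x"
proof -
  interpret c: Vector_Spaces.linear scale "(*)" counit by (rule counit_linear)
  have "counit x = (\<Sum>n | hcomp n x \<noteq> 0. counit (hcomp n x))"
    by (subst sum_hcomp[symmetric]) (simp only: c.sum)
  also have "\<dots> = (\<Sum>n | hcomp n x \<noteq> 0. if n = 0 then counit (hcomp 0 x) else 0)"
    by (rule sum.cong) (auto intro: gr_counit hcomp_in_gr)
  also have "\<dots> = counit (hcomp 0 x)"
    using finite_hcomp[of x] by (auto simp: c.zero)
  finally have "counit x = counit (hcomp 0 x)" .
  moreover obtain c where "hcomp 0 x = scale c 1"
    using gr_0_scalar[OF hcomp_in_gr] .
  ultimately show ?thesis by (simp add: c.scale counit_one)
qed

end

section \<open>The shape of the coproduct\<close>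

context connected_graded_hopf_algebra
begin

definition comult_closed :: "'h set \<Rightarrow> bool" where
  "comult_closed U \<longleftrightarrow> (\<forall>x\<in>U. comult x \<in> tensor2_span scale (U \<times> U))"

text \<open>
  The pairs of homogeneous elements of \<open>U\<close> that may occur in the reduced coproduct of an element
  of degree \<open>n\<close>.
\<close>

definition positive_pairs :: "'h set \<Rightarrow> nat \<Rightarrow> ('h \<times> 'h) set" where
  "positive_pairs U n =
     (\<Union>(i, j)\<in>{(i, j). i > 0 \<and> j > 0 \<and> i + j = n}. (U \<inter> gr i) \<times> (U \<inter> gr j))"

lemma positive_pairs_mono: "U \<inter> below n \<subseteq> V \<Longrightarrow> positive_pairs U n \<subseteq> positive_pairs V n"
  by (fastforce simp: positive_pairs_def below_def)

lemma positive_pairs_subset: "U \<inter> below n \<subseteq> V \<Longrightarrow> positive_pairs U n \<subseteq> V \<times> V"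
  by (fastforce simp: positive_pairs_def below_def)

text \<open>
  Projecting onto total degree \<open>n\<close> makes the coproduct of \<open>x\<close> simultaneously graded and
  supported on \<open>U\<close>; the two extreme components are identified by the counit.
\<close>

lemma comult_graded:
  assumes U: "graded_subspace U" "comult_closed U" and x: "x \<in> U" "x \<in> gr n" and n: "0 < n"
  shows "comult x - (pure2 1 x + pure2 x 1) \<in> tensor2_span scale (positive_pairs U n)"
proof -
  let ?R = "bilinear_rels scale"
  let ?P = "\<Union>i\<le>n. (U \<inter> gr i) \<times> (U \<inter> gr (n - i))"
  define f where "f = (\<lambda>(a, b). \<Sum>i\<le>n. pure2 (hcomp i a) (hcomp (n - i) b) :: ('h \<times> 'h) \<Rightarrow>\<^sub>0 'k)"
  (* The projection onto total degree n; it respects the bilinearity relations. *)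
  define pr where "pr = free_lift fscale f"
  have pr_rels: "pr r \<in> ?R" if "r \<in> ?R" for r
    unfolding pr_def
  proof (rule F.free_lift_bilinear_rels[OF subspace_bilinear_rels that])
    fix x x' y
    have "f (x + x', y) - f (x, y) - f (x', y) = (\<Sum>i\<le>n. pure2 (hcomp i x + hcomp i x') (hcomp (n - i) y) -
        (pure2 (hcomp i x) (hcomp (n - i) y) + pure2 (hcomp i x') (hcomp (n - i) y)))"
      by (simp add: f_def hcomp_add hcomp_scale sum_subtractf sum.distrib F.scale_sum_right)
    then show "f (x + x', y) - f (x, y) - f (x', y) \<in> ?R"
      using tensor2_eq_pure_add_left[of scale]
      by (simp add: tensor2_eq_def F.subspace_sum[OF subspace_bilinear_rels])
  next
    fix x y y'
    have "f (x, y + y') - f (x, y) - f (x, y') = (\<Sum>i\<le>n. pure2 (hcomp i x) (hcomp (n - i) y + hcomp (n - i) y') -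
        (pure2 (hcomp i x) (hcomp (n - i) y) + pure2 (hcomp i x) (hcomp (n - i) y')))"
      by (simp add: f_def hcomp_add hcomp_scale sum_subtractf sum.distrib F.scale_sum_right)
    then show "f (x, y + y') - f (x, y) - f (x, y') \<in> ?R"
      using tensor2_eq_pure_add_right[of scale]
      by (simp add: tensor2_eq_def F.subspace_sum[OF subspace_bilinear_rels])
  next
    fix c x y
    have "f (scale c x, y) - fscale c (f (x, y)) = (\<Sum>i\<le>n. pure2 (scale c (hcomp i x)) (hcomp (n - i) y) -
        fscale c (pure2 (hcomp i x) (hcomp (n - i) y)))"
      by (simp add: f_def hcomp_add hcomp_scale sum_subtractf sum.distrib F.scale_sum_right)
    then show "f (scale c x, y) - fscale c (f (x, y)) \<in> ?R"
      using tensor2_eq_pure_scale_left[of scale]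
      by (simp add: tensor2_eq_def F.subspace_sum[OF subspace_bilinear_rels])
  next
    fix c x y
    have "f (x, scale c y) - fscale c (f (x, y)) = (\<Sum>i\<le>n. pure2 (hcomp i x) (scale c (hcomp (n - i) y)) -
        fscale c (pure2 (hcomp i x) (hcomp (n - i) y)))"
      by (simp add: f_def hcomp_add hcomp_scale sum_subtractf sum.distrib F.scale_sum_right)
    then show "f (x, scale c y) - fscale c (f (x, y)) \<in> ?R"
      using tensor2_eq_pure_scale_right[of scale]
      by (simp add: tensor2_eq_def F.subspace_sum[OF subspace_bilinear_rels])
  qed
  have lin: "Vector_Spaces.linear fscale fscale pr"
    unfolding pr_def by (rule F.linear_free_lift)
  have lin': "Vector_Spaces.linear fscale fscale (\<lambda>p. pr p - p)"
    by (intro Vector_Spaces.linear_iff[THEN iffD2] conjI allI vector_space_fscale)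
       (auto simp: pr_def F.free_lift_add F.free_lift_fscale algebra_simps)
  have "pr (comult x) - comult x \<in> ?R"
  proof (rule tensor2_span_linear_image[OF lin' gr_comult[OF x(2)] subspace_bilinear_rels])
    fix a b assume "(a, b) \<in> (\<Union>i\<le>n. gr i \<times> gr (n - i))"
    then obtain i where i: "i \<le> n" "a \<in> gr i" "b \<in> gr (n - i)" by blast
    have "pr (pure2 a b) = (\<Sum>j\<le>n. pure2 (hcomp j a) (hcomp (n - j) b))"
      by (simp add: pr_def f_def F.free_lift_pure2)
    also have "\<dots> = pure2 a b + (\<Sum>j\<in>{..n} - {i}. pure2 (hcomp j a) (hcomp (n - j) b))"
      using i by (subst sum.remove[of _ i]) (auto simp: hcomp_gr)
    also have "\<dots> = pure2 a b + (\<Sum>j\<in>{..n} - {i}. pure2 0 (hcomp (n - j) b))"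
      using i(2) by (intro arg_cong2[of _ _ _ _ "(+)"] sum.cong) (auto simp: hcomp_gr)
    finally show "pr (pure2 a b) - pure2 a b \<in> ?R"
      using tensor2_eq_pure_zero_left[of scale]
      by (auto simp: tensor2_eq_def intro!: F.subspace_sum[OF subspace_bilinear_rels])
  qed (use pr_rels F.subspace_diff[OF subspace_bilinear_rels] in blast)
  moreover have "pr (comult x) \<in> tensor2_span scale ?P"
  proof (rule tensor2_span_linear_image[OF lin _ subspace_tensor2_span])
    show "comult x \<in> tensor2_span scale (U \<times> U)" using U(2) x(1) by (auto simp: comult_closed_def)
    show "pr (pure2 a b) \<in> tensor2_span scale ?P" if "(a, b) \<in> U \<times> U" for a b
      using that U(1)
      by (auto simp: pr_def f_def F.free_lift_pure2 graded_subspace_def hcomp_in_gr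
          intro!: F.subspace_sum[OF subspace_tensor2_span] pure2_in_tensor2_span)
  qed (use pr_rels rels_subset_tensor2_span in blast)
  ultimately have com: "comult x \<in> tensor2_span scale ?P"
    using tensor2_span_cong[OF tensor2_eq_sym] unfolding tensor2_eq_def by blast
  let ?N = "tensor2_span scale (positive_pairs U n)"
  have zero: "pure2 (0::'h) (1::'h) \<in> ?N" "pure2 (1::'h) (0::'h) \<in> ?N"
    by (rule tensor2_span_cong[OF tensor2_eq_pure_zero_left tensor2_span_zero]
        tensor2_span_cong[OF tensor2_eq_pure_zero_right tensor2_span_zero])+
  (* The tensors of the form 1 (x) y + y' (x) 1 plus a tensor of the required shape. *)
  let ?T = "{p. \<exists>y\<in>gr n. \<exists>y'\<in>gr n. p - (pure2 1 y + pure2 y' 1) \<in> ?N}"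
  have "tensor2_span scale ?P \<subseteq> ?T"
  proof (rule tensor2_span_minimal)
    show "F.subspace ?T"
    proof (rule F.subspaceI)
      have "0 - (pure2 1 0 + pure2 0 1) \<in> ?N"
        by (intro tensor2_span_diff tensor2_span_add tensor2_span_zero zero)
      then show "0 \<in> ?T" using subspace_0[OF gr_subspace] by blast
    next
      fix p q assume "p \<in> ?T" "q \<in> ?T"
      then obtain y y' w w' where y: "y \<in> gr n" "y' \<in> gr n" "w \<in> gr n" "w' \<in> gr n"
        and "p - (pure2 1 y + pure2 y' 1) \<in> ?N" "q - (pure2 1 w + pure2 w' 1) \<in> ?N" by blast
      then have "(p - (pure2 1 y + pure2 y' 1)) + (q - (pure2 1 w + pure2 w' 1)) \<in> ?N"
        by (intro tensor2_span_add)
      moreover have "(p - (pure2 1 y + pure2 y' 1)) + (q - (pure2 1 w + pure2 w' 1)) =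
          p + q - ((pure2 1 y + pure2 1 w) + (pure2 y' 1 + pure2 w' 1))"
        by (simp add: algebra_simps)
      ultimately have "p + q - ((pure2 1 y + pure2 1 w) + (pure2 y' 1 + pure2 w' 1)) \<in> ?N"
        by simp
      then have "p + q - (pure2 1 (y + w) + pure2 (y' + w') 1) \<in> ?N"
        by (rule tensor2_span_cong[rotated, OF _ tensor2_eq_diff[OF tensor2_eq_refl tensor2_eq_add[OF
              tensor2_eq_pure_add_right tensor2_eq_pure_add_left]]])
      then show "p + q \<in> ?T" using y subspace_add[OF gr_subspace] by blast
    next
      fix c p assume "p \<in> ?T"
      then obtain y y' where y: "y \<in> gr n" "y' \<in> gr n"
        and "p - (pure2 1 y + pure2 y' 1) \<in> ?N" by blast
      then have "fscale c (p - (pure2 1 y + pure2 y' 1)) \<in> ?N"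
        by (intro F.subspace_scale[OF subspace_tensor2_span])
      then have "fscale c p - (fscale c (pure2 1 y) + fscale c (pure2 y' 1)) \<in> ?N"
        by (simp add: F.scale_right_diff_distrib F.scale_right_distrib)
      then have "fscale c p - (pure2 1 (scale c y) + pure2 (scale c y') 1) \<in> ?N"
        by (rule tensor2_span_cong[rotated, OF _ tensor2_eq_diff[OF tensor2_eq_refl tensor2_eq_add[OF
              tensor2_eq_pure_scale_right tensor2_eq_pure_scale_left]]])
      then show "fscale c p \<in> ?T" using y subspace_scale[OF gr_subspace] by blast
    qed
    fix a b assume "(a, b) \<in> ?P"
    then obtain i where i: "i \<le> n" and a: "a \<in> U" "a \<in> gr i" and b: "b \<in> U" "b \<in> gr (n - i)"
      by blast
    consider "i = 0" | "i = n" | "0 < i" "i < n" using i by linarith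
    then show "pure2 a b \<in> ?T"
    proof cases
      case 1
      obtain c where c: "a = scale c 1" using gr_0_scalar[OF a(2)[unfolded 1]] .
      have "tensor2_eq scale (pure2 a b) (pure2 1 (scale c b))"
        unfolding c using tensor2_eq_trans[OF tensor2_eq_pure_scale_left
            tensor2_eq_sym[OF tensor2_eq_pure_scale_right]] .
      then have "pure2 a b - pure2 1 (scale c b) \<in> ?N"
        using rels_subset_tensor2_span by (auto simp: tensor2_eq_def)
      from tensor2_span_diff[OF this zero(1)]
      have "pure2 a b - (pure2 1 (scale c b) + pure2 0 1) \<in> ?N" by (simp add: diff_diff_eq)
      moreover have "scale c b \<in> gr n" using 1 b(2) subspace_scale[OF gr_subspace] by simp
      ultimately show ?thesis using subspace_0[OF gr_subspace] by blast
    next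
      case 2
      then have "b \<in> gr 0" using b(2) by simp
      from gr_0_scalar[OF this] obtain c where c: "b = scale c 1" .
      have "tensor2_eq scale (pure2 a b) (pure2 (scale c a) 1)"
        unfolding c using tensor2_eq_trans[OF tensor2_eq_pure_scale_right
            tensor2_eq_sym[OF tensor2_eq_pure_scale_left]] .
      then have "pure2 a b - pure2 (scale c a) 1 \<in> ?N"
        using rels_subset_tensor2_span by (auto simp: tensor2_eq_def)
      from tensor2_span_diff[OF this zero(2)]
      have "pure2 a b - (pure2 1 0 + pure2 (scale c a) 1) \<in> ?N" by (simp add: algebra_simps)
      moreover have "scale c a \<in> gr n" using 2 a(2) subspace_scale[OF gr_subspace] by simp
      ultimately show ?thesis using subspace_0[OF gr_subspace] by blast
    next
      case 3
      then have "(a, b) \<in> positive_pairs U n"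
        using a b unfolding positive_pairs_def by (intro UN_I[of "(i, n - i)"]) auto
      then have "pure2 a b \<in> ?N" by (rule pure2_in_tensor2_span)
      then have "pure2 a b - (pure2 1 0 + pure2 0 1) \<in> ?N"
        by (intro tensor2_span_diff tensor2_span_add zero)
      then show ?thesis using subspace_0[OF gr_subspace] by blast
    qed
  next
    show "?R \<subseteq> ?T"
    proof
      fix r assume "r \<in> ?R"
      have "r - (pure2 1 0 + pure2 0 1) \<in> ?N"
        using \<open>r \<in> ?R\<close> rels_subset_tensor2_span
        by (intro tensor2_span_diff tensor2_span_add zero) blast
      then show "r \<in> ?T" using subspace_0[OF gr_subspace] by blast
    qed
  qed
  with com obtain y y' where y: "y \<in> gr n" "y' \<in> gr n"
    and N: "comult x - (pure2 1 y + pure2 y' 1) \<in> ?N" by blast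
  interpret c: Vector_Spaces.linear scale "(*)" counit by (rule counit_linear)
  let ?l = "free_lift scale (\<lambda>(a, b). scale (counit a) b)"
  let ?r = "free_lift scale (\<lambda>(a, b). scale (counit b) a)"
  have pos: "counit a = 0" "counit b = 0" if "(a, b) \<in> positive_pairs U n" for a b
    using that by (auto simp: positive_pairs_def intro: gr_counit)
  (* Applying the counit to either factor kills the tensors of positive bidegree and recovers y, y'. *)
  have l0: "?l p \<in> {0}" if "p \<in> ?N" for p
  proof (rule tensor2_span_linear_image[OF linear_free_lift that subspace_single_0])
    show "?l q \<in> {0}" if "q \<in> ?R" for q
      by (rule free_lift_bilinear_rels[OF subspace_single_0 that])
         (simp_all add: c.add c.scale scale_left_distrib scale_right_distrib mult.commute)
  qed (simp add: free_lift_pure2 pos)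
  have r0: "?r p \<in> {0}" if "p \<in> ?N" for p
  proof (rule tensor2_span_linear_image[OF linear_free_lift that subspace_single_0])
    show "?r q \<in> {0}" if "q \<in> ?R" for q
      by (rule free_lift_bilinear_rels[OF subspace_single_0 that])
         (simp_all add: c.add c.scale scale_left_distrib scale_right_distrib mult.commute)
  qed (simp add: free_lift_pure2 pos)
  have "counit y = 0" "counit y' = 0" using y n by (auto intro: gr_counit)
  then have "x = y" "x = y'"
    using l0[OF N] r0[OF N] counit_left[of x] counit_right[of x]
    by (auto simp: free_lift_diff free_lift_add free_lift_pure2 counit_one)
  then show ?thesis using N by simp
qed

end

section \<open>Graded subbialgebras and their closure under commutators\<close>

context connected_graded_hopf_algebra
begin

definition subbialgebra :: "'h set \<Rightarrow> bool" where
  "subbialgebra B \<longleftrightarrow> is_subalgebra scale B \<and> graded_subspace B \<and> comult_closed B"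

lemma subbialgebra_UNIV: "subbialgebra UNIV"
proof -
  have "F.span (range (\<lambda>(x, y). pure2 x y)) \<subseteq> tensor2_span scale (UNIV \<times> UNIV)"
    by (intro F.span_minimal subspace_tensor2_span) (auto intro: pure2_in_tensor2_span)
  moreover have "p \<in> F.span (range (\<lambda>(x, y). pure2 x y))" for p :: "('h \<times> 'h) \<Rightarrow>\<^sub>0 'k"
  proof -
    have "p = (\<Sum>x\<in>Poly_Mapping.keys p. fscale (Poly_Mapping.lookup p x) (case_prod pure2 x))"
      by (rule poly_mapping_eqI)
         (auto simp: lookup_sum lookup_fscale pure2_def lookup_single when_def case_prod_unfold
           in_keys_iff if_distrib[of "(*) _"] cong: if_cong)
    also have "\<dots> \<in> F.span (range (\<lambda>(x, y). pure2 x y))"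
      by (intro F.span_sum F.span_scale F.span_base rangeI)
    finally show ?thesis .
  qed
  ultimately have "p \<in> tensor2_span scale (UNIV \<times> UNIV)" for p :: "('h \<times> 'h) \<Rightarrow>\<^sub>0 'k"
    by blast
  then show ?thesis
    by (simp add: subbialgebra_def comult_closed_def graded_subspace_UNIV is_subalgebra_def)
qed

lemma comult_closed_Alg:
  assumes "\<And>g. g \<in> X \<Longrightarrow> comult g \<in> tensor2_span scale (Alg X \<times> Alg X)"
  shows "comult_closed (Alg X)"
  unfolding comult_closed_def
proof
  fix x assume "x \<in> Alg X"
  then show "comult x \<in> tensor2_span scale (Alg X \<times> Alg X)"
  proof (induction rule: Alg_induct)
    case one
    show ?case
      by (rule tensor2_span_cong[OF comult_one]) (auto intro: pure2_in_tensor2_span Alg_one)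
  next
    case (mult x y)
    then show ?case
      by (intro tensor2_span_cong[OF comult_mult] tensor2_mult_in_span) (auto intro: Alg_mult)
  next
    case (add x y)
    then show ?case by (intro tensor2_span_cong[OF comult_add] tensor2_span_add)
  next
    case (scale c x)
    then show ?case
      by (intro tensor2_span_cong[OF comult_scale] F.subspace_scale[OF subspace_tensor2_span])
  qed (rule assms)
qed

lemma comult_diff: "tensor2_eq scale (comult (x - y)) (comult x - comult y)"
  using tensor2_eq_diff[OF comult_add[of "x - y" y] tensor2_eq_refl[of scale "comult y"]]
  by (simp add: tensor2_eq_sym)

abbreviation primitive_part :: "'h \<Rightarrow> 'h \<times> 'h \<Rightarrow>\<^sub>0 'k" where
  "primitive_part v \<equiv> pure2 1 v + pure2 v 1"

definition tensor2_commutator ::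
    "('h \<times> 'h \<Rightarrow>\<^sub>0 'k) \<Rightarrow> ('h \<times> 'h \<Rightarrow>\<^sub>0 'k) \<Rightarrow> 'h \<times> 'h \<Rightarrow>\<^sub>0 'k" where
  "tensor2_commutator p q = tensor2_mult p q - tensor2_mult q p"

lemma pure2_diff_in_span:
  assumes "(x - x', y) \<in> P"
  shows "pure2 x y - pure2 x' y \<in> tensor2_span scale P"
  by (rule tensor2_span_cong[OF tensor2_eq_sym[OF tensor2_eq_pure_diff_left]
        pure2_in_tensor2_span[OF assms]])

lemma pure2_diff_in_span':
  assumes "(x, y - y') \<in> P"
  shows "pure2 x y - pure2 x y' \<in> tensor2_span scale P"
  by (rule tensor2_span_cong[OF tensor2_eq_sym[OF tensor2_eq_pure_diff_right]
        pure2_in_tensor2_span[OF assms]])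

lemma commutator_primitive_part:
  assumes q: "q \<in> tensor2_span scale (B \<times> B)" and v: "\<And>b. b \<in> B \<Longrightarrow> v * b - b * v \<in> B"
  shows "tensor2_commutator (primitive_part v) q \<in> tensor2_span scale (B \<times> B)"
proof (rule tensor2_span_linear_image[OF _ q subspace_tensor2_span])
  show "Vector_Spaces.linear fscale fscale (tensor2_commutator (primitive_part v))"
    by (intro Vector_Spaces.linear_iff[THEN iffD2] conjI allI vector_space_fscale)
       (simp_all add: tensor2_commutator_def tensor2_mult_add_left tensor2_mult_add_right
         tensor2_mult_fscale_left tensor2_mult_fscale_right
         F.scale_right_diff_distrib F.scale_right_distrib)
  fix a b assume "(a, b) \<in> B \<times> B"
  then have "(pure2 a (v * b) - pure2 a (b * v)) + (pure2 (v * a) b - pure2 (a * v) b)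
      \<in> tensor2_span scale (B \<times> B)"
    by (intro tensor2_span_add pure2_diff_in_span pure2_diff_in_span') (auto intro: v)
  then show "tensor2_commutator (primitive_part v) (pure2 a b) \<in> tensor2_span scale (B \<times> B)"
    by (simp add: tensor2_commutator_def tensor2_mult_add_left tensor2_mult_add_right
        tensor2_mult_pure2 algebra_simps)
qed (unfold tensor2_commutator_def, intro tensor2_span_diff;
    use tensor2_mult_rels_left tensor2_mult_rels_right rels_subset_tensor2_span in blast)

lemma commutator_primitive_parts:
  assumes "v * w - w * v \<in> B" "1 \<in> B"
  shows "tensor2_commutator (primitive_part v) (primitive_part w) \<in> tensor2_span scale (B \<times> B)"
proof -
  have "(pure2 1 (v * w) - pure2 1 (w * v)) + (pure2 (v * w) 1 - pure2 (w * v) 1)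
      \<in> tensor2_span scale (B \<times> B)"
    using assms by (intro tensor2_span_add pure2_diff_in_span pure2_diff_in_span') auto
  then show ?thesis
    by (simp add: tensor2_commutator_def tensor2_mult_add_left tensor2_mult_add_right
        tensor2_mult_pure2 algebra_simps)
qed

lemma comult_commutator:
  "tensor2_eq scale (comult (v * w - w * v)) (tensor2_commutator (comult v) (comult w))"
  unfolding tensor2_commutator_def
  by (rule tensor2_eq_trans[OF comult_diff tensor2_eq_diff[OF comult_mult comult_mult]])

lemma tensor2_commutator_in_span:
  assumes "is_subalgebra scale B" "p \<in> tensor2_span scale (B \<times> B)" "q \<in> tensor2_span scale (B \<times> B)"
  shows "tensor2_commutator p q \<in> tensor2_span scale (B \<times> B)"
  unfolding tensor2_commutator_def
  using assms by (intro tensor2_span_diff tensor2_mult_in_span) (auto simp: is_subalgebra_def)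

text \<open>
  Because \<open>\<Delta>[v, w] = [\<Delta> v, \<Delta> w]\<close>, and the commutator of \<open>1 \<otimes> v + v \<otimes> 1\<close> with a pure tensor is a
  sum of commutators with \<open>v\<close> in a single factor.
\<close>

lemma comult_commutator_in_span:
  assumes B: "is_subalgebra scale B"
    and v: "comult v - primitive_part v \<in> tensor2_span scale (B \<times> B)"
      "\<And>b. b \<in> B \<Longrightarrow> v * b - b * v \<in> B"
    and w: "comult w \<in> tensor2_span scale (B \<times> B)"
  shows "comult (v * w - w * v) \<in> tensor2_span scale (B \<times> B)"
proof -
  have "tensor2_commutator (comult v - primitive_part v) (comult w) +
      tensor2_commutator (primitive_part v) (comult w) \<in> tensor2_span scale (B \<times> B)"
    by (intro tensor2_span_add tensor2_commutator_in_span commutator_primitive_part assms)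
  then show ?thesis
    by (intro tensor2_span_cong[OF comult_commutator])
       (simp add: tensor2_commutator_def tensor2_mult_add_left tensor2_mult_add_right
         tensor2_mult_diff_left tensor2_mult_diff_right algebra_simps)
qed

text \<open>
  The same for two elements normalising \<open>B\<close>: the extra term is the commutator of
  \<open>1 \<otimes> v + v \<otimes> 1\<close> and \<open>1 \<otimes> w + w \<otimes> 1\<close>, in which the mixed products \<open>v \<otimes> w\<close> and
  \<open>w \<otimes> v\<close> cancel.
\<close>

lemma comult_commutator_in_span':
  assumes B: "is_subalgebra scale B"
    and v: "comult v - primitive_part v \<in> tensor2_span scale (B \<times> B)"
      "\<And>b. b \<in> B \<Longrightarrow> v * b - b * v \<in> B"
    and w: "comult w - primitive_part w \<in> tensor2_span scale (B \<times> B)"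
      "\<And>b. b \<in> B \<Longrightarrow> w * b - b * w \<in> B"
    and vw: "v * w - w * v \<in> B"
  shows "comult (v * w - w * v) \<in> tensor2_span scale (B \<times> B)"
proof -
  have "1 \<in> B" using B by (simp add: is_subalgebra_def)
  then have "(tensor2_commutator (comult v - primitive_part v) (comult w - primitive_part w) +
      tensor2_commutator (primitive_part v) (comult w - primitive_part w)) -
      (tensor2_commutator (primitive_part w) (comult v - primitive_part v) -
      tensor2_commutator (primitive_part v) (primitive_part w)) \<in> tensor2_span scale (B \<times> B)"
    by (intro tensor2_span_add tensor2_span_diff tensor2_commutator_in_span
        commutator_primitive_part commutator_primitive_parts assms)
  then show ?thesis
    by (intro tensor2_span_cong[OF comult_commutator])
       (simp add: tensor2_commutator_def tensor2_mult_add_left tensor2_mult_add_right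
         tensor2_mult_diff_left tensor2_mult_diff_right algebra_simps)
qed

text \<open>
  Closing a generating set, rather than the subalgebra itself, under commutators keeps all
  generators homogeneous; the subalgebra inherits the closure because commutation with a fixed
  element is a derivation.
\<close>

inductive_set ad_closure :: "nat \<Rightarrow> 'h set \<Rightarrow> 'h set" for n U where
  ad_base: "x \<in> U \<Longrightarrow> x \<in> below n \<Longrightarrow> x \<in> ad_closure n U"
| ad_comm: "v \<in> U \<Longrightarrow> v \<in> gr n \<Longrightarrow> w \<in> U \<Longrightarrow> w \<in> gr n \<Longrightarrow> v * w - w * v \<in> ad_closure n U"
| ad_step: "v \<in> U \<Longrightarrow> v \<in> gr n \<Longrightarrow> g \<in> ad_closure n U \<Longrightarrow> v * g - g * v \<in> ad_closure n U"

text \<open>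
  The least subalgebra of \<open>U\<close> that contains the elements of \<open>U\<close> of degree below \<open>n\<close> and
  modulo which the elements of \<open>U\<close> of degree \<open>n\<close> commute with each other and with it.
\<close>

definition ad_hull :: "nat \<Rightarrow> 'h set \<Rightarrow> 'h set" where
  "ad_hull n U = Alg (ad_closure n U)"

lemma ad_closure_degree:
  "g \<in> ad_closure n U \<Longrightarrow> 0 < n \<Longrightarrow> g \<in> U \<inter> below n \<or> (\<exists>m>n. g \<in> gr m)"
proof (induction rule: ad_closure.induct)
  case (ad_comm v w)
  then have "n < n + n" "v * w - w * v \<in> gr (n + n)" by (auto intro: commutator_in_gr)
  then show ?case by blast
next
  case (ad_step v g)
  then obtain m where m: "0 < m" "g \<in> gr m"
    unfolding below_def by (metis IntD2 UN_E greaterThanLessThan_iff order.strict_trans)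
  then have "n < n + m" "v * g - g * v \<in> gr (n + m)"
    using ad_step by (auto intro: commutator_in_gr)
  then show ?case by blast
qed auto

lemma ad_closure_pos: "0 < n \<Longrightarrow> ad_closure n U \<subseteq> pos_homogeneous"
  using ad_closure_degree[of _ n U] below_subset_pos[of n]
  by (fastforce simp: pos_homogeneous_def)

lemma ad_hull_least:
  assumes A: "is_subalgebra scale A" and U: "U \<inter> below (Suc n) \<subseteq> A" and n: "0 < n"
  shows "ad_hull n U \<subseteq> A"
proof -
  have diff: "x - y \<in> A" if "x \<in> A" "y \<in> A" for x y
    using A that by (auto simp: is_subalgebra_def intro: subspace_diff)
  have mult: "x * y \<in> A" if "x \<in> A" "y \<in> A" for x y
    using A that by (auto simp: is_subalgebra_def)
  have "g \<in> A" if "g \<in> ad_closure n U" for g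
    using that
    by induction (use U n in \<open>auto simp: below_Suc intro!: diff mult\<close>)
  then show ?thesis unfolding ad_hull_def by (intro Alg_minimal A) auto
qed

lemma ad_hull_subset: "is_subalgebra scale U \<Longrightarrow> 0 < n \<Longrightarrow> ad_hull n U \<subseteq> U"
  by (rule ad_hull_least) auto

lemma ad_hull_base: "U \<inter> below n \<subseteq> ad_hull n U"
  unfolding ad_hull_def by (auto intro: Alg_base ad_base)

lemma subalgebra_ad_hull: "is_subalgebra scale (ad_hull n U)"
  unfolding ad_hull_def by (rule subalgebra_Alg)

lemma ad_hull_comm:
  "v \<in> U \<inter> gr n \<Longrightarrow> w \<in> U \<inter> gr n \<Longrightarrow> v * w - w * v \<in> ad_hull n U"
  unfolding ad_hull_def by (auto intro: Alg_base ad_comm)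

lemma ad_hull_normal:
  assumes v: "v \<in> U \<inter> gr n" and x: "x \<in> ad_hull n U"
  shows "v * x - x * v \<in> ad_hull n U"
proof -
  let ?A = "Alg (ad_closure n U)"
  have "x \<in> ?A \<and> v * x - x * v \<in> ?A"
    using x unfolding ad_hull_def
  proof (induction rule: Alg_induct)
    case (base g)
    with v show ?case by (auto intro!: Alg_base intro: ad_step)
  next
    case one
    show ?case by (simp add: Alg_one subspace_0 subspace_Alg)
  next
    case (mult x y)
    have "v * (x * y) - x * y * v = (v * x - x * v) * y + x * (v * y - y * v)"
      by (simp add: algebra_simps)
    with mult show ?case by (auto intro: Alg_mult subspace_add[OF subspace_Alg])
  next
    case (add x y)
    have "v * (x + y) - (x + y) * v = (v * x - x * v) + (v * y - y * v)"
      by (simp add: algebra_simps)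
    with add show ?case by (auto intro: subspace_add[OF subspace_Alg])
  next
    case (scale c x)
    have "v * scale c x - scale c x * v = scale c (v * x - x * v)"
      by (simp add: scale_mult_left scale_mult_right scale_right_diff_distrib)
    with scale show ?case by (auto intro: subspace_scale[OF subspace_Alg])
  qed
  then show ?thesis by (simp add: ad_hull_def)
qed

text \<open>All further generators of the closure have degree above \<open>n\<close>, so none appears in degree \<open>n\<close>.\<close>

lemma ad_hull_gr:
  assumes "0 < n" "x \<in> ad_hull n U" "x \<in> gr n"
  shows "x \<in> Alg (U \<inter> below n)"
proof -
  have low: "g \<in> U \<inter> below n \<or> g = 0" if "g \<in> ad_closure n U" "g \<in> gr m" "m \<le> n" for g m
    using ad_closure_degree[OF that(1) assms(1)] gr_unique[OF that(2)] that(3) by fastforce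
  have "x \<in> Alg (ad_closure n U \<inter> below n)"
  proof (rule Alg_gr_no_letter[OF ad_closure_pos[OF assms(1)] _ assms(3)])
    show "ad_closure n U \<inter> gr n \<subseteq> {0}"
    proof clarsimp
      fix g assume g: "g \<in> ad_closure n U" "g \<in> gr n"
      show "g = 0"
      proof (rule ccontr)
        assume "g \<noteq> 0"
        with low[OF g] have "g \<in> below n" by auto
        then show False using gr_unique[OF g(2) _ \<open>g \<noteq> 0\<close>] by (auto simp: below_def)
      qed
    qed
  qed (use assms(2) in \<open>simp add: ad_hull_def\<close>)
  moreover have "ad_closure n U \<inter> below n \<subseteq> Alg (U \<inter> below n)"
  proof
    fix g assume "g \<in> ad_closure n U \<inter> below n"
    then obtain m where "g \<in> ad_closure n U" "g \<in> gr m" "m \<le> n" by (auto simp: below_def)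
    from low[OF this] show "g \<in> Alg (U \<inter> below n)"
      using Alg_base subspace_0[OF subspace_Alg] by blast
  qed
  ultimately show ?thesis using Alg_least by blast
qed

text \<open>
  Elements of \<open>U\<close> of degree at most \<open>n\<close> are primitive up to tensors in degrees below \<open>n\<close>, which
  lie in the hull; so commutators with them stay in the hull after applying \<open>\<Delta>\<close>.
\<close>

lemma subbialgebra_ad_hull:
  assumes U: "subbialgebra U" and n: "0 < n"
  shows "subbialgebra (ad_hull n U)"
proof -
  let ?B = "ad_hull n U"
  have U': "graded_subspace U" "comult_closed U"
    using U by (auto simp: subbialgebra_def)
  have delta: "comult v - primitive_part v \<in> tensor2_span scale (?B \<times> ?B)"
    if "v \<in> U" "v \<in> gr m" "0 < m" "m \<le> n" for v m
  proof -
    have "U \<inter> below m \<subseteq> ?B" using ad_hull_base[of U n] below_mono[OF \<open>m \<le> n\<close>] by blast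
    then show ?thesis
      using comult_graded[OF U' that(1-3)] tensor2_span_mono[OF positive_pairs_subset] by blast
  qed
  have one: "1 \<in> ?B" unfolding ad_hull_def by (rule Alg_one)
  have "comult_closed (Alg (ad_closure n U))"
  proof (rule comult_closed_Alg, fold ad_hull_def)
    fix g assume "g \<in> ad_closure n U"
    then show "comult g \<in> tensor2_span scale (?B \<times> ?B)"
    proof (induction rule: ad_closure.induct)
      case (ad_base x)
      then obtain m where m: "x \<in> gr m" "0 < m" "m \<le> n" by (auto simp: below_def)
      have "x \<in> ?B" using ad_base ad_hull_base by blast
      then have "primitive_part x \<in> tensor2_span scale (?B \<times> ?B)"
        by (intro tensor2_span_add pure2_in_tensor2_span) (auto simp: one)
      from tensor2_span_add[OF delta[OF ad_base(1) m] this] show ?case by simp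
    next
      case (ad_comm v w)
      then show ?case using n
        by (intro comult_commutator_in_span' subalgebra_ad_hull delta[of _ n])
           (auto intro: ad_hull_normal ad_hull_comm)
    next
      case (ad_step v g)
      then show ?case using n
        by (intro comult_commutator_in_span subalgebra_ad_hull delta[of _ n])
           (auto intro: ad_hull_normal)
    qed
  qed
  then show ?thesis
    using graded_Alg[OF ad_closure_pos[OF n]] subalgebra_ad_hull
    by (simp add: subbialgebra_def ad_hull_def)
qed

end

section \<open>The tower of subbialgebras and the generators\<close>

context connected_graded_hopf_algebra
begin

text \<open>
  Each step refines a finite chain of subbialgebras by placing the commutator hull of a member
  in degree \<open>N + 1\<close> next to it. The two agree in degrees up to \<open>N\<close>.
\<close>

primrec levels :: "nat \<Rightarrow> 'h set set" where
  "levels 0 = {UNIV}"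
| "levels (Suc N) = levels N \<union> ad_hull (Suc N) ` levels N"

lemma finite_levels: "finite (levels N)"
  by (induction N) auto

lemma levels_mono: "m \<le> n \<Longrightarrow> levels m \<subseteq> levels n"
  by (induction n) (auto simp: le_Suc_eq)

lemma levels_subbialgebra: "U \<in> levels N \<Longrightarrow> subbialgebra U"
  by (induction N arbitrary: U) (auto intro: subbialgebra_UNIV subbialgebra_ad_hull)

lemma levels_subalgebra: "U \<in> levels N \<Longrightarrow> is_subalgebra scale U"
  using levels_subbialgebra by (auto simp: subbialgebra_def)

lemma levels_graded: "U \<in> levels N \<Longrightarrow> graded_subspace U"
  using levels_subbialgebra by (auto simp: subbialgebra_def)

lemma ad_hull_subset_Alg: "0 < n \<Longrightarrow> ad_hull n U \<subseteq> Alg (U \<inter> below (Suc n))"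
  by (rule ad_hull_least[OF subalgebra_Alg]) (auto intro: Alg_base)

lemma Alg_below_subset_ad_hull: "Alg (U \<inter> below n) \<subseteq> ad_hull n U"
  by (rule Alg_minimal[OF ad_hull_base subalgebra_ad_hull])

lemma below_inter_ad_hull:
  assumes "is_subalgebra scale U" "0 < n" "m \<le> n"
  shows "ad_hull n U \<inter> below m = U \<inter> below m"
  using ad_hull_subset[OF assms(1,2)] ad_hull_base[of U n] below_mono[OF assms(3)] by blast

text \<open>
  Nestedness alone would not survive the next step, in which the larger member shrinks to its
  hull. The part of it that is generated in low degrees stays inside the hull, and the smaller
  member lies in this part.
\<close>

lemma levels_chain:
  "T \<in> levels N \<Longrightarrow> U \<in> levels N \<Longrightarrow>
     T = U \<or> T \<subseteq> Alg (U \<inter> below (Suc N)) \<or> U \<subseteq> Alg (T \<inter> below (Suc N))"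
proof (induction N arbitrary: T U)
  case (Suc N)
  let ?R = "ad_hull (Suc N)" and ?t = "\<lambda>n U. Alg (U \<inter> below (Suc n))"
  have sub: "?R U \<subseteq> U" if "U \<in> levels N" for U
    using ad_hull_subset levels_subalgebra that by blast
  have t: "?t N U \<subseteq> ?t (Suc N) U" for U
    by (rule Alg_mono) (use below_mono[of "Suc N" "Suc (Suc N)"] in auto)
  have tR: "?t N U \<subseteq> ?t (Suc N) (?R U)" if "U \<in> levels N" for U
    using below_inter_ad_hull[OF levels_subalgebra[OF that], of "Suc N" "Suc N"]
      t[of "?R U"] by simp
  have R: "?R U \<subseteq> ?t (Suc N) U" for U
    by (rule ad_hull_subset_Alg) simp
  (* One inclusion one level down gives all four comparisons between the old and the new members. *)
  have main: "T' = U' \<or> T' \<subseteq> ?t (Suc N) U' \<or> U' \<subseteq> ?t (Suc N) T'"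
    if TU: "T \<in> levels N" "U \<in> levels N" "T \<subseteq> ?t N U" and "T' \<in> {T, ?R T}" "U' \<in> {U, ?R U}"
    for T U T' U'
  proof -
    have "T' \<subseteq> T" using sub that by auto
    moreover have "T \<subseteq> ?t (Suc N) U'" using t[of U] tR[of U] that by auto
    ultimately show ?thesis by blast
  qed
  obtain T' U' where TU: "T' \<in> levels N" "T \<in> {T', ?R T'}" "U' \<in> levels N" "U \<in> {U', ?R U'}"
    using Suc.prems by auto
  consider "T' = U'" | "T' \<subseteq> ?t N U'" | "U' \<subseteq> ?t N T'" using Suc.IH[OF TU(1,3)] by blast
  then show ?case
  proof cases
    case 1
    then show ?thesis using TU R[of U'] by auto
  next
    case 2
    show ?thesis by (rule main[OF TU(1,3) 2 TU(2,4)])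
  next
    case 3
    show ?thesis using main[OF TU(3,1) 3 TU(4,2)] by blast
  qed
qed simp

text \<open>
  No later member cuts through the interval between \<open>R\<^sub>m(T)\<close> and the part of \<open>T\<close> of degree at
  most \<open>m\<close>: step \<open>k + 1\<close> changes a member only in degrees above \<open>k\<close>.
\<close>

lemma levels_compare:
  assumes m: "0 < m" and T: "T \<in> levels (m - 1)" and U: "U \<in> levels k" "m \<le> k"
  shows "T \<inter> below (Suc m) \<subseteq> U \<or> U \<subseteq> ad_hull m T"
  using U(2,1)
proof (induction k arbitrary: U rule: dec_induct)
  case base
  obtain N where N: "m = Suc N" using m by (cases m) auto
  then obtain V where V: "V \<in> levels N" "U = V \<or> U = ad_hull m V" using base by auto
  have sub: "ad_hull m V \<subseteq> V" using ad_hull_subset levels_subalgebra V(1) m by blast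
  consider "V = T" | "T \<subseteq> Alg (V \<inter> below m)" | "V \<subseteq> Alg (T \<inter> below m)"
    using levels_chain[OF V(1), of T] T N by auto
  then show ?case
    using V(2) sub Alg_below_subset_ad_hull[of V m] Alg_below_subset_ad_hull[of T m] by cases auto
next
  case (step k)
  then consider "U \<in> levels k" | V where "V \<in> levels k" "U = ad_hull (Suc k) V" by auto
  then show ?case
  proof cases
    case 2
    have "ad_hull (Suc k) V \<subseteq> V" using ad_hull_subset levels_subalgebra 2(1) by blast
    moreover have "V \<inter> below (Suc m) \<subseteq> U"
      using ad_hull_base[of V "Suc k"] below_mono[of "Suc m" "Suc k"] step.hyps 2(2) by auto
    ultimately show ?thesis using step.IH[OF 2(1)] 2(2) by blast
  qed (rule step.IH)
qed

text \<open>
  A node is a place where a member of a level is split: the degree of the splitting and the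
  member. The new generators of the node live between its two algebras \<open>lo\<close> and \<open>hi\<close>.
\<close>

definition nodes :: "(nat \<times> 'h set) set" where
  "nodes = {(n, U). 0 < n \<and> U \<in> levels (n - 1)}"

abbreviation lo :: "nat \<times> 'h set \<Rightarrow> 'h set" where
  "lo a \<equiv> ad_hull (fst a) (snd a)"

abbreviation hi :: "nat \<times> 'h set \<Rightarrow> 'h set" where
  "hi a \<equiv> Alg (snd a \<inter> below (Suc (fst a)))"

lemma lo_subset_hi: "a \<in> nodes \<Longrightarrow> lo a \<subseteq> hi a"
  by (auto simp: nodes_def intro: ad_hull_subset_Alg[THEN subsetD])

lemma lo_in_levels: "a \<in> nodes \<Longrightarrow> lo a \<in> levels (fst a)"
proof -
  assume "a \<in> nodes"
  then obtain N U where "a = (Suc N, U)" "U \<in> levels N"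
    by (cases a; cases "fst a") (auto simp: nodes_def)
  then show ?thesis by simp
qed

text \<open>
  For nodes of equal degree this is the chain property of a level. Otherwise the member split at
  the higher degree lies on one side of the interval of the other node.
\<close>

lemma nodes_linear:
  assumes "a \<in> nodes" "b \<in> nodes" "a \<noteq> b"
  shows "hi a \<subseteq> lo b \<or> hi b \<subseteq> lo a"
proof -
  have less: "hi a \<subseteq> lo b \<or> hi b \<subseteq> lo a"
    if "a \<in> nodes" "b \<in> nodes" "fst a < fst b" for a b
  proof -
    obtain m T n U where a: "a = (m, T)" and b: "b = (n, U)" by (cases a, cases b)
    with that(1,2) have a: "a = (m, T)" "0 < m" "T \<in> levels (m - 1)"
      and b: "b = (n, U)" "0 < n" "U \<in> levels (n - 1)"
      by (simp_all add: nodes_def)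
    have "m \<le> n - 1" using that(3) a b by simp
    from levels_compare[OF a(2,3) b(3) this] show ?thesis
    proof
      assume "T \<inter> below (Suc m) \<subseteq> U"
      moreover have "below (Suc m) \<subseteq> below n" using \<open>m \<le> n - 1\<close> b(2) by (intro below_mono) simp
      ultimately have "T \<inter> below (Suc m) \<subseteq> U \<inter> below n" by blast
      then have "Alg (T \<inter> below (Suc m)) \<subseteq> ad_hull n U"
        using Alg_mono Alg_below_subset_ad_hull by blast
      then show ?thesis using a b by simp
    next
      assume U: "U \<subseteq> ad_hull m T"
      have "Alg (U \<inter> below (Suc n)) \<subseteq> U"
        by (rule Alg_minimal[OF _ levels_subalgebra[OF b(3)]]) simp
      then show ?thesis using a b U by auto
    qed
  qed
  have eq: "hi a \<subseteq> lo b" if "a \<in> nodes" "b \<in> nodes" "fst a = fst b"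
    "snd a \<subseteq> Alg (snd b \<inter> below (fst b))" for a b
  proof -
    have "hi a \<subseteq> snd a"
      using that levels_subalgebra by (intro Alg_minimal) (auto simp: nodes_def)
    then show ?thesis using Alg_below_subset_ad_hull[of "snd b" "fst b"] that by blast
  qed
  consider "fst a < fst b" | "fst b < fst a" | "fst a = fst b" by linarith
  then show ?thesis
  proof cases
    case 3
    then have "snd a \<noteq> snd b" using assms(3) by (simp add: prod_eq_iff)
    moreover have "snd a \<in> levels (fst a - 1)" "snd b \<in> levels (fst a - 1)" "0 < fst a"
      using assms 3 by (auto simp: nodes_def)
    ultimately have "snd a \<subseteq> Alg (snd b \<inter> below (fst b)) \<or> snd b \<subseteq> Alg (snd a \<inter> below (fst a))"
      using levels_chain[of "snd a" "fst a - 1" "snd b"] 3 by simp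
    then show ?thesis using eq[of a b] eq[of b a] assms 3 by auto
  qed (use less assms in blast)+
qed

text \<open>
  A basis of a complement of the lower algebra of the node, in the degree of the node; independence
  modulo the lower algebra is expressed without passing to a quotient.
\<close>

definition is_layer :: "nat \<times> 'h set \<Rightarrow> 'h set \<Rightarrow> bool" where
  "is_layer a B \<longleftrightarrow>
     B \<subseteq> snd a \<inter> gr (fst a) \<and>
     snd a \<inter> gr (fst a) \<subseteq> span (B \<union> (lo a \<inter> gr (fst a))) \<and>
     (\<forall>b\<in>B. b \<notin> span ((B - {b}) \<union> (lo a \<inter> gr (fst a))))"

definition layer :: "nat \<times> 'h set \<Rightarrow> 'h set" where
  "layer a = (SOME B. is_layer a B)"

lemma is_layer_layer:
  assumes "a \<in> nodes"
  shows "is_layer a (layer a)"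
proof -
  let ?K = "lo a \<inter> gr (fst a)" and ?V = "snd a \<inter> gr (fst a)"
  have K: "?K \<subseteq> ?V"
    using assms ad_hull_subset[of "snd a" "fst a"] levels_subalgebra by (auto simp: nodes_def)
  obtain C where C: "C \<subseteq> ?K" "independent C" "?K \<subseteq> span C"
    using maximal_independent_subset[of ?K] by blast
  obtain D where D: "C \<subseteq> D" "D \<subseteq> ?V" "independent D" "?V \<subseteq> span D"
    using maximal_independent_subset_extend[of C ?V] C K by blast
  have "is_layer a (D - C)"
    unfolding is_layer_def
  proof (intro conjI ballI)
    show "D - C \<subseteq> ?V" using D by blast
    have "span D \<subseteq> span ((D - C) \<union> ?K)" using C by (intro span_mono) blast
    then show "?V \<subseteq> span ((D - C) \<union> ?K)" using D(4) by blast
    fix b assume b: "b \<in> D - C"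
    have "?K \<subseteq> span (D - {b})" using C(3) span_mono[of C "D - {b}"] D(1) b by blast
    moreover have "D - C - {b} \<subseteq> span (D - {b})" using span_superset[of "D - {b}"] by blast
    ultimately have "span ((D - C - {b}) \<union> ?K) \<subseteq> span (D - {b})"
      by (intro span_minimal) auto
    moreover have "b \<notin> span (D - {b})" using D(3) b by (auto simp: dependent_def)
    ultimately show "b \<notin> span ((D - C - {b}) \<union> ?K)" by blast
  qed
  then show ?thesis unfolding layer_def by (rule someI)
qed

lemma
  assumes "a \<in> nodes" "\<gamma> \<in> layer a"
  shows layer_in: "\<gamma> \<in> snd a" and layer_gr: "\<gamma> \<in> gr (fst a)"
    and layer_not_span: "\<gamma> \<notin> span ((layer a - {\<gamma>}) \<union> (lo a \<inter> gr (fst a)))"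
    and layer_not_lo: "\<gamma> \<notin> lo a" and layer_nonzero: "\<gamma> \<noteq> 0"
    and layer_hi: "\<gamma> \<in> hi a" and layer_hdeg: "hdeg gr \<gamma> = fst a"
proof -
  show 1: "\<gamma> \<in> snd a" "\<gamma> \<in> gr (fst a)"
    and 2: "\<gamma> \<notin> span ((layer a - {\<gamma>}) \<union> (lo a \<inter> gr (fst a)))"
    using is_layer_layer[OF assms(1)] assms(2) unfolding is_layer_def by blast+
  show "\<gamma> \<notin> lo a" using 1 2 by (auto intro: span_base)
  show "\<gamma> \<noteq> 0" using 2 span_zero by metis
  then show "hdeg gr \<gamma> = fst a" using 1 by (auto intro: hdeg_eq)
  have "0 < fst a" using assms by (auto simp: nodes_def)
  then show "\<gamma> \<in> hi a" using 1 gr_subset_below[of "fst a" "Suc (fst a)"] by (auto intro!: Alg_base)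
qed

definition generators :: "'h set" where
  "generators = (\<Union>a\<in>nodes. layer a)"

definition node_of :: "'h \<Rightarrow> nat \<times> 'h set" where
  "node_of \<gamma> = (THE a. a \<in> nodes \<and> \<gamma> \<in> layer a)"

lemma hi_not_subset_lo:
  assumes "a \<in> nodes" "b \<in> nodes" "\<gamma> \<in> layer a" "\<gamma> \<in> layer b"
  shows "\<not> hi a \<subseteq> lo b"
  using layer_hi[OF assms(1,3)] layer_not_lo[OF assms(2,4)] by blast

lemma node_of_eq:
  assumes "a \<in> nodes" "\<gamma> \<in> layer a"
  shows "node_of \<gamma> = a"
  unfolding node_of_def
proof (rule the_equality)
  fix b assume b: "b \<in> nodes \<and> \<gamma> \<in> layer b"
  show "b = a"
  proof (rule ccontr)
    assume "b \<noteq> a"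
    then show False
      using nodes_linear[of a b] hi_not_subset_lo[of a b \<gamma>] hi_not_subset_lo[of b a \<gamma>] assms b by auto
  qed
qed (use assms in blast)

lemma generators_node:
  assumes "\<gamma> \<in> generators"
  shows "node_of \<gamma> \<in> nodes" "\<gamma> \<in> layer (node_of \<gamma>)"
  using assms node_of_eq by (auto simp: generators_def)

definition well_ordering :: "'h rel" where
  "well_ordering = (SOME r. well_order_on UNIV r)"

lemma well_order_well_ordering: "well_order_on UNIV well_ordering"
  unfolding well_ordering_def by (rule someI_ex) (rule well_order_on)

text \<open>
  Within a node every linear order satisfies the commutator condition; a well-ordering makes the
  whole order well-founded in bounded degree.
\<close>

definition generator_less :: "'h \<Rightarrow> 'h \<Rightarrow> bool" where
  "generator_less \<gamma> \<delta> \<longleftrightarrow>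
     hi (node_of \<gamma>) \<subseteq> lo (node_of \<delta>) \<or>
     node_of \<gamma> = node_of \<delta> \<and> (\<gamma>, \<delta>) \<in> well_ordering - Id"

definition generator_order :: "'h rel" where
  "generator_order = {(\<gamma>, \<delta>) \<in> generators \<times> generators. \<gamma> = \<delta> \<or> generator_less \<gamma> \<delta>}"

lemma generator_node_irrefl:
  "\<gamma> \<in> generators \<Longrightarrow> \<not> hi (node_of \<gamma>) \<subseteq> lo (node_of \<gamma>)"
  using hi_not_subset_lo generators_node by blast

lemma generator_less_irrefl: "\<gamma> \<in> generators \<Longrightarrow> \<not> generator_less \<gamma> \<gamma>"
  using generator_node_irrefl by (auto simp: generator_less_def)

lemma generator_less_trans:
  assumes "\<gamma> \<in> generators" "\<delta> \<in> generators" "\<epsilon> \<in> generators"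
    and "generator_less \<gamma> \<delta>" "generator_less \<delta> \<epsilon>"
  shows "generator_less \<gamma> \<epsilon>"
proof -
  have "trans (well_ordering - Id)"
    using well_order_well_ordering
    by (auto simp: order_on_defs intro: trans_diff_Id)
  then show ?thesis
    using assms(4,5) lo_subset_hi[OF generators_node(1)[OF assms(2)]]
    unfolding generator_less_def by (auto dest: transD)
qed

lemma generator_less_total:
  assumes "\<gamma> \<in> generators" "\<delta> \<in> generators" "\<gamma> \<noteq> \<delta>"
  shows "generator_less \<gamma> \<delta> \<or> generator_less \<delta> \<gamma>"
proof (cases "node_of \<gamma> = node_of \<delta>")
  case True
  have "total_on UNIV well_ordering"
    using well_order_well_ordering by (auto simp: order_on_defs)
  then show ?thesis using True assms(3) by (auto simp: generator_less_def total_on_def)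
next
  case False
  then show ?thesis
    using nodes_linear generators_node assms by (auto simp: generator_less_def)
qed

lemma linear_order_generators: "linear_order_on generators generator_order"
  unfolding linear_order_on_def partial_order_on_def preorder_on_def
proof (intro conjI)
  show "generator_order \<subseteq> generators \<times> generators" "refl_on generators generator_order"
    "total_on generators generator_order"
    using generator_less_total by (auto simp: generator_order_def refl_on_def total_on_def)
  show "trans generator_order"
    unfolding generator_order_def by (rule transI) (use generator_less_trans in blast)
  show "antisym generator_order"
    unfolding generator_order_def
    by (rule antisymI) (use generator_less_trans generator_less_irrefl in blast)
qed

abbreviation lower_generators :: "'h \<Rightarrow> 'h set" where
  "lower_generators \<gamma> \<equiv> {\<delta> \<in> generators. (\<delta>, \<gamma>) \<in> generator_order \<and> \<delta> \<noteq> \<gamma>}"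

lemma lower_generators_iff:
  "\<gamma> \<in> generators \<Longrightarrow>
     \<delta> \<in> lower_generators \<gamma> \<longleftrightarrow> \<delta> \<in> generators \<and> generator_less \<delta> \<gamma>"
  using generator_less_irrefl by (auto simp: generator_order_def)

text \<open>
  In each degree only finitely many nodes occur, so the order restricted to bounded degree is a
  finite concatenation of well-orders.
\<close>

lemma wf_generators_below:
  "wf {(\<delta>, \<gamma>). \<gamma> \<in> generators \<inter> below d \<and> \<delta> \<in> lower_generators \<gamma> \<inter> below d}"
proof -
  define M where "M = node_of ` (generators \<inter> below d)"
  define N where "N = {(a, b) \<in> M \<times> M. hi a \<subseteq> lo b}"
  have "M \<subseteq> {..d} \<times> levels d"
  proof
    fix a assume "a \<in> M"
    then obtain \<gamma> where \<gamma>: "\<gamma> \<in> generators" "\<gamma> \<in> below d" "a = node_of \<gamma>" by (auto simp: M_def)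
    then have a: "a \<in> nodes" "\<gamma> \<in> layer a" using generators_node by auto
    from \<gamma>(2) obtain i where i: "i < d" "\<gamma> \<in> gr i" by (auto simp: below_def)
    then have "fst a < d" using gr_unique layer_gr[OF a] layer_nonzero[OF a] by blast
    moreover from this have "levels (fst a - 1) \<subseteq> levels d" by (intro levels_mono) simp
    moreover have "snd a \<in> levels (fst a - 1)" using a(1) by (auto simp: nodes_def)
    ultimately show "a \<in> {..d} \<times> levels d" by (auto simp: mem_Times_iff)
  qed
  then have "finite M" using finite_subset finite_levels by blast
  then have "finite N" using finite_subset[of N "M \<times> M"] by (auto simp: N_def)
  moreover have "trans N"
  proof (rule transI)
    fix a b c assume "(a, b) \<in> N" "(b, c) \<in> N"
    moreover from this have "lo b \<subseteq> hi b"
      by (intro lo_subset_hi) (auto simp: N_def M_def intro: generators_node)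
    ultimately show "(a, c) \<in> N" by (auto simp: N_def)
  qed
  moreover have "irrefl N"
  proof (rule irreflI)
    fix a
    show "(a, a) \<notin> N"
      using generator_node_irrefl unfolding N_def M_def by blast
  qed
  ultimately have "wf N"
    by (intro finite_acyclic_wf) (simp_all add: acyclic_irrefl)
  moreover have "wf (well_ordering - Id)"
    using well_order_well_ordering by (auto simp: well_order_on_def)
  ultimately have "wf (inv_image (N <*lex*> (well_ordering - Id)) (\<lambda>\<gamma>. (node_of \<gamma>, \<gamma>)))"
    by (intro wf_inv_image wf_lex_prod)
  then show ?thesis
    by (rule wf_subset)
       (auto simp: N_def M_def generator_order_def generator_less_def)
qed

text \<open>
  In degree \<open>d\<close> a member is either generated from below, or it is unchanged since level \<open>d - 1\<close>, so
  that the node of degree \<open>d\<close> at that earlier member accounts for it.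
\<close>

lemma levels_trace:
  assumes "V \<in> levels k" "0 < d"
  shows "V \<inter> gr d \<subseteq> Alg (V \<inter> below d) \<or>
    (\<exists>V'\<in>levels (d - 1). V' \<inter> below (Suc d) = V \<inter> below (Suc d))"
  using assms(1)
proof (induction k arbitrary: V)
  case 0
  then have "V \<in> levels (d - 1)" using levels_mono[of 0 "d - 1"] by auto
  then show ?case by blast
next
  case (Suc k)
  show ?case
  proof (cases "Suc k < d")
    case True
    then have "levels (Suc k) \<subseteq> levels (d - 1)" by (intro levels_mono) simp
    then have "V \<in> levels (d - 1)" using Suc.prems by blast
    then show ?thesis by blast
  next
    case False
    consider "V \<in> levels k" | W where "W \<in> levels k" "V = ad_hull (Suc k) W"
      using Suc.prems by auto
    then show ?thesis
    proof cases
      case 2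
      have W: "is_subalgebra scale W" by (rule levels_subalgebra[OF 2(1)])
      have d: "V \<inter> below d = W \<inter> below d"
        using below_inter_ad_hull[OF W] False 2(2) by simp
      show ?thesis
      proof (cases "d = Suc k")
        case True
        then have "V \<inter> gr d \<subseteq> Alg (W \<inter> below d)"
          using ad_hull_gr[of d _ W] assms(2) 2(2) by auto
        then show ?thesis using d by simp
      next
        case neq: False
        then have eq: "V \<inter> below (Suc d) = W \<inter> below (Suc d)"
          using below_inter_ad_hull[OF W] False 2(2) by simp
        then have "V \<inter> gr d = W \<inter> gr d"
          using gr_subset_below[of d "Suc d"] assms(2) by blast
        then show ?thesis using Suc.IH[OF 2(1)] eq d by simp
      qed
    qed (rule Suc.IH)
  qed
qed

lemma levels_generated_gr:
  assumes "V \<in> levels k"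
  shows "V \<inter> gr d \<subseteq> Alg (generators \<inter> V)"
proof (induction d rule: less_induct)
  case (less d)
  show ?case
  proof (cases "d = 0")
    case True
    show ?thesis
    proof
      fix x assume "x \<in> V \<inter> gr d"
      then have "x \<in> gr 0" using True by simp
      from gr_0_scalar[OF this] obtain c where "x = scale c 1" .
      then show "x \<in> Alg (generators \<inter> V)"
        using subspace_scale[OF subspace_Alg Alg_one] by simp
    qed
  next
    case False
    then have d: "0 < d" by simp
    have low: "V \<inter> below d \<subseteq> Alg (generators \<inter> V)"
    proof
      fix x assume x: "x \<in> V \<inter> below d"
      then obtain i where "i < d" "x \<in> gr i" by (auto simp: below_def)
      then show "x \<in> Alg (generators \<inter> V)" using less[of i] x by blast
    qed
    from levels_trace[OF assms d] show ?thesis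
    proof
      assume "V \<inter> gr d \<subseteq> Alg (V \<inter> below d)"
      then show ?thesis using Alg_least[OF low] by blast
    next
      assume "\<exists>V'\<in>levels (d - 1). V' \<inter> below (Suc d) = V \<inter> below (Suc d)"
      then obtain V' where V': "V' \<in> levels (d - 1)" "V' \<inter> below (Suc d) = V \<inter> below (Suc d)"
        by blast
      have a: "(d, V') \<in> nodes" using V'(1) d by (simp add: nodes_def)
      have gr: "V' \<inter> gr d = V \<inter> gr d"
        using V'(2) gr_subset_below[of d "Suc d"] d by blast
      have below: "V' \<inter> below d = V \<inter> below d"
        using V'(2) below_mono[of d "Suc d"] by auto
      have "layer (d, V') \<subseteq> Alg (generators \<inter> V)"
        using layer_in[OF a] layer_gr[OF a] gr a by (auto simp: generators_def intro!: Alg_base)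
      moreover have "ad_hull d V' \<inter> gr d \<subseteq> Alg (generators \<inter> V)"
        using ad_hull_gr[OF d, of _ V'] Alg_least[OF low] below by auto
      ultimately have "span (layer (d, V') \<union> (ad_hull d V' \<inter> gr d)) \<subseteq> Alg (generators \<inter> V)"
        by (intro span_minimal subspace_Alg) auto
      moreover have "V' \<inter> gr d \<subseteq> span (layer (d, V') \<union> (ad_hull d V' \<inter> gr d))"
        using is_layer_layer[OF a] by (simp add: is_layer_def)
      ultimately show ?thesis using gr by blast
    qed
  qed
qed

lemma levels_generated:
  assumes "V \<in> levels k"
  shows "V \<subseteq> Alg (generators \<inter> V)"
proof
  fix x assume "x \<in> V"
  then have "hcomp n x \<in> V \<inter> gr n" for n
    using levels_graded[OF assms] hcomp_in_gr by (auto simp: graded_subspace_def)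
  then have "hcomp n x \<in> Alg (generators \<inter> V)" for n
    using levels_generated_gr[OF assms] by blast
  then show "x \<in> Alg (generators \<inter> V)" by (rule in_subspace_if_hcomp[OF subspace_Alg])
qed

lemma generators_generate: "Alg generators = UNIV"
  using levels_generated[of UNIV 0] by auto

lemma generators_pos: "generators \<subseteq> pos_homogeneous"
  using layer_gr by (fastforce simp: generators_def pos_homogeneous_def nodes_def)

text \<open>
  The lower algebra of a node is itself a member of the next level, hence is generated by the
  generators it contains; all of these come from earlier nodes.
\<close>

lemma lo_subset_Alg_lower:
  assumes "\<gamma> \<in> generators"
  shows "lo (node_of \<gamma>) \<subseteq> Alg (lower_generators \<gamma>)"
proof -
  let ?a = "node_of \<gamma>"
  note a = generators_node[OF assms]
  have "generators \<inter> lo ?a \<subseteq> lower_generators \<gamma>"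
  proof
    fix \<delta> assume \<delta>: "\<delta> \<in> generators \<inter> lo ?a"
    then have b: "node_of \<delta> \<in> nodes" "\<delta> \<in> layer (node_of \<delta>)" using generators_node by auto
    have "\<not> hi ?a \<subseteq> lo (node_of \<delta>)"
      using \<delta> lo_subset_hi[OF a(1)] layer_not_lo[OF b] by blast
    moreover have "node_of \<delta> \<noteq> ?a" using \<delta> layer_not_lo[OF b] by auto
    ultimately have "hi (node_of \<delta>) \<subseteq> lo ?a" using nodes_linear[OF a(1) b(1)] by metis
    then show "\<delta> \<in> lower_generators \<gamma>"
      using \<delta> by (subst lower_generators_iff[OF assms]) (auto simp: generator_less_def)
  qed
  then show ?thesis
    using levels_generated[OF lo_in_levels[OF a(1)]] Alg_mono by blast
qed

lemma lower_generators_cases: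
  assumes "\<gamma> \<in> generators" "\<delta> \<in> lower_generators \<gamma>"
  shows "\<delta> \<in> lo (node_of \<gamma>) \<or> \<delta> \<in> layer (node_of \<gamma>) - {\<gamma>}"
proof -
  have \<delta>: "\<delta> \<in> generators" "generator_less \<delta> \<gamma>" "\<delta> \<noteq> \<gamma>"
    using assms lower_generators_iff by auto
  then show ?thesis
    using generators_node[OF \<delta>(1)] layer_hi[OF generators_node[OF \<delta>(1)]]
    unfolding generator_less_def by auto
qed

text \<open>
  In the degree of \<open>\<gamma>\<close> the algebra of the smaller generators consists of the lower algebra of the
  node and the span of the smaller elements of the same layer, from which \<open>\<gamma>\<close> is independent.
\<close>

lemma generator_not_in_Alg_lower:
  assumes \<gamma>: "\<gamma> \<in> generators"
  shows "\<gamma> \<notin> Alg (lower_generators \<gamma>)"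
proof
  let ?a = "node_of \<gamma>" and ?L = "lower_generators \<gamma>"
  note a = generators_node[OF \<gamma>]
  assume "\<gamma> \<in> Alg ?L"
  moreover have "?L \<subseteq> pos_homogeneous" using generators_pos by auto
  ultimately obtain p q where p: "p \<in> span (?L \<inter> gr (fst ?a))"
    and q: "q \<in> Alg (?L \<inter> below (fst ?a)) \<inter> gr (fst ?a)" and pq: "\<gamma> = p + q"
    using Alg_gr_decompose[OF _ _ layer_gr[OF a], of ?L] by blast
  let ?S = "(layer ?a - {\<gamma>}) \<union> (lo ?a \<inter> gr (fst ?a))"
  have "?L \<inter> below (fst ?a) \<subseteq> lo ?a"
  proof
    fix \<delta> assume \<delta>: "\<delta> \<in> ?L \<inter> below (fst ?a)"
    then obtain i where i: "i < fst ?a" "\<delta> \<in> gr i" by (auto simp: below_def)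
    have "\<delta> \<notin> layer ?a"
      using gr_unique[OF i(2)] layer_gr[OF a(1)] layer_nonzero[OF a(1)] i(1) by blast
    then show "\<delta> \<in> lo ?a" using lower_generators_cases[OF \<gamma>] \<delta> by blast
  qed
  then have "q \<in> lo ?a" using Alg_minimal[OF _ subalgebra_ad_hull] q by blast
  then have "q \<in> span ?S" using q by (intro span_base) auto
  moreover have "?L \<inter> gr (fst ?a) \<subseteq> ?S" using lower_generators_cases[OF \<gamma>] by blast
  then have "p \<in> span ?S" using p span_mono by blast
  ultimately show False using layer_not_span[OF a] pq span_add by blast
qed

lemma generator_commutator:
  assumes \<gamma>: "\<gamma> \<in> generators" and \<delta>: "\<delta> \<in> lower_generators \<gamma>"
  shows "\<gamma> * \<delta> - \<delta> * \<gamma> \<in> Alg (lower_generators \<gamma>)"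
proof -
  note a = generators_node[OF \<gamma>]
  have v: "\<gamma> \<in> snd (node_of \<gamma>) \<inter> gr (fst (node_of \<gamma>))" using layer_in[OF a] layer_gr[OF a] by simp
  from lower_generators_cases[OF \<gamma> \<delta>] have "\<gamma> * \<delta> - \<delta> * \<gamma> \<in> lo (node_of \<gamma>)"
  proof
    assume "\<delta> \<in> layer (node_of \<gamma>) - {\<gamma>}"
    then show ?thesis using layer_in[OF a(1)] layer_gr[OF a(1)] by (intro ad_hull_comm v) auto
  qed (rule ad_hull_normal[OF v])
  then show ?thesis using lo_subset_Alg_lower[OF \<gamma>] by blast
qed

lemma generator_comult:
  assumes \<gamma>: "\<gamma> \<in> generators"
  shows "comult \<gamma> - primitive_part \<gamma> \<in>
    tensor2_span scale (positive_pairs (Alg (lower_generators \<gamma>)) (hdeg gr \<gamma>))"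
proof -
  let ?a = "node_of \<gamma>"
  note a = generators_node[OF \<gamma>]
  have U: "graded_subspace (snd ?a)" "comult_closed (snd ?a)" "0 < fst ?a"
    using a(1) levels_subbialgebra by (auto simp: nodes_def subbialgebra_def)
  have "snd ?a \<inter> below (fst ?a) \<subseteq> Alg (lower_generators \<gamma>)"
    using ad_hull_base lo_subset_Alg_lower[OF \<gamma>] by blast
  then have "tensor2_span scale (positive_pairs (snd ?a) (fst ?a)) \<subseteq>
      tensor2_span scale (positive_pairs (Alg (lower_generators \<gamma>)) (fst ?a))"
    by (intro tensor2_span_mono positive_pairs_mono)
  then show ?thesis
    using comult_graded[OF U(1,2) layer_in[OF a] layer_gr[OF a] U(3)] layer_hdeg[OF a] by auto
qed

end

section \<open>Ordered words over a linear order\<close>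

lemma ordered_words_Cons:
  "x # w \<in> ordered_words I r \<longleftrightarrow> x \<in> I \<and> w \<in> ordered_words I r \<and> (\<forall>y\<in>set w. (x, y) \<in> r)"
  by (auto simp: ordered_words_def)

lemma ordered_word_of_mset:
  assumes r: "linear_order_on I r" and "set w \<subseteq> I"
  obtains w' where "w' \<in> ordered_words I r" "mset w' = mset w"
proof -
  have trans: "(x, z) \<in> r" if "(x, y) \<in> r" "(y, z) \<in> r" for x y z
    using r that by (auto simp: order_on_defs dest: transD)
  have total: "(x, y) \<in> r \<or> (y, x) \<in> r" if "x \<in> I" "y \<in> I" for x y
    using r that by (cases "x = y") (auto simp: order_on_defs total_on_def refl_on_def)
  have insert: "\<exists>zs\<in>ordered_words I r. mset zs = add_mset x (mset ys)"
    if "x \<in> I" "ys \<in> ordered_words I r" for x ys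
    using that(2)
  proof (induction ys)
    case Nil
    then show ?case using that(1) by (intro bexI[of _ "[x]"]) (auto simp: ordered_words_def)
  next
    case (Cons y ys)
    show ?case
    proof (cases "(x, y) \<in> r")
      case True
      then show ?thesis
        using Cons.prems that(1) trans
        by (intro bexI[of _ "x # y # ys"]) (auto simp: ordered_words_Cons)
    next
      case False
      have yx: "(y, x) \<in> r" using False total[OF that(1), of y] Cons.prems by (auto simp: ordered_words_Cons)
      obtain zs where zs: "zs \<in> ordered_words I r" "mset zs = add_mset x (mset ys)"
        using Cons by (auto simp: ordered_words_Cons)
      have "set zs = insert x (set ys)" using arg_cong[OF zs(2), of set_mset] by simp
      then show ?thesis
        using Cons.prems zs yx by (intro bexI[of _ "y # zs"]) (auto simp: ordered_words_Cons)
    qed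
  qed
  have "\<exists>w'\<in>ordered_words I r. mset w' = mset w"
    using assms(2)
  proof (induction w)
    case Nil
    then show ?case by (intro bexI[of _ "[]"]) (auto simp: ordered_words_def)
  next
    case (Cons x w)
    then obtain w' where "w' \<in> ordered_words I r" "mset w' = mset w" by auto
    then show ?case using insert[of x w'] Cons.prems by simp
  qed
  then show thesis using that by blast
qed

lemma ordered_word_unique:
  assumes r: "antisym r" and "v \<in> ordered_words I r" "w \<in> ordered_words I r" "mset v = mset w"
  shows "v = w"
  using assms(2-)
proof (induction v arbitrary: w)
  case (Cons a v)
  then obtain b w' where w: "w = b # w'" by (cases w) auto
  have s: "set (a # v) = set w" using Cons.prems(3) by (metis set_mset_mset)
  have "a = b"
  proof (rule ccontr)
    assume "a \<noteq> b"
    then have "a \<in> set w'" "b \<in> set v" using s w by auto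
    then show False
      using Cons.prems(1,2) w \<open>a \<noteq> b\<close> antisymD[OF r] by (auto simp: ordered_words_Cons)
  qed
  then show ?case using Cons w by (auto simp: ordered_words_Cons)
qed simp

lemma finite_linear_order_max:
  assumes "linear_order_on I r" "finite A" "A \<noteq> {}" "A \<subseteq> I"
  obtains m where "m \<in> A" "\<forall>x\<in>A. (x, m) \<in> r"
proof -
  have "\<exists>m\<in>A. \<forall>x\<in>A. (x, m) \<in> r"
    using assms(2-4)
  proof (induction A rule: finite_ne_induct)
    case (singleton x)
    then show ?case using assms(1) by (auto simp: order_on_defs refl_on_def)
  next
    case (insert x A)
    then obtain m where m: "m \<in> A" "\<forall>x\<in>A. (x, m) \<in> r" by auto
    have "(x, m) \<in> r \<or> (m, x) \<in> r"
      using insert m(1) assms(1) by (auto simp: order_on_defs total_on_def)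
    moreover have "(x, x) \<in> r" using insert assms(1) by (auto simp: order_on_defs refl_on_def)
    moreover have "trans r" using assms(1) by (auto simp: order_on_defs)
    ultimately show ?case using m by (auto dest: transD)
  qed
  then show thesis using that by blast
qed

section \<open>Triangular families of generators\<close>

text \<open>
  The order need not be well-founded: in the enveloping algebra of a free Lie algebra on two
  letters, the generators constructed above descend forever, with growing degrees. Descending chains of bounded degree are finite, and that is
  enough because all relations are homogeneous.
\<close>

locale pbw_generators = connected_graded_hopf_algebra scale comult counit antipode gr
  for scale :: "'k::field_char_0 \<Rightarrow> 'h::ring_1 \<Rightarrow> 'h"
    and comult :: "'h \<Rightarrow> ('h \<times> 'h \<Rightarrow>\<^sub>0 'k)"
    and counit :: "'h \<Rightarrow> 'k"
    and antipode :: "'h \<Rightarrow> 'h"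
    and gr :: "nat \<Rightarrow> 'h set" +
  fixes \<Gamma> :: "'h set" and r :: "'h rel"
  assumes linear_order: "linear_order_on \<Gamma> r"
    and homogeneous: "\<Gamma> \<subseteq> pos_homogeneous"
    and triangular_comult: "\<gamma> \<in> \<Gamma> \<Longrightarrow> comult \<gamma> - primitive_part \<gamma> \<in>
      tensor2_span scale (positive_pairs (Alg {\<delta> \<in> \<Gamma>. (\<delta>, \<gamma>) \<in> r \<and> \<delta> \<noteq> \<gamma>}) (hdeg gr \<gamma>))"
    and triangular_commutator: "\<gamma> \<in> \<Gamma> \<Longrightarrow> \<delta> \<in> \<Gamma> \<Longrightarrow> (\<delta>, \<gamma>) \<in> r \<Longrightarrow> \<delta> \<noteq> \<gamma> \<Longrightarrow>
      \<gamma> * \<delta> - \<delta> * \<gamma> \<in> Alg {\<delta> \<in> \<Gamma>. (\<delta>, \<gamma>) \<in> r \<and> \<delta> \<noteq> \<gamma>}"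
    and not_in_lower: "\<gamma> \<in> \<Gamma> \<Longrightarrow> \<gamma> \<notin> Alg {\<delta> \<in> \<Gamma>. (\<delta>, \<gamma>) \<in> r \<and> \<delta> \<noteq> \<gamma>}"
    and generate: "Alg \<Gamma> = UNIV"
    and wf_below: "wf {(\<delta>, \<gamma>). \<gamma> \<in> \<Gamma> \<inter> below d \<and>
      \<delta> \<in> {\<delta> \<in> \<Gamma>. (\<delta>, \<gamma>) \<in> r \<and> \<delta> \<noteq> \<gamma>} \<inter> below d}"
begin

abbreviation lower :: "'h \<Rightarrow> 'h set" where
  "lower \<gamma> \<equiv> {\<delta> \<in> \<Gamma>. (\<delta>, \<gamma>) \<in> r \<and> \<delta> \<noteq> \<gamma>}"

abbreviation deg :: "'h \<Rightarrow> nat" where "deg \<equiv> hdeg gr"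

abbreviation wdeg :: "'h list \<Rightarrow> nat" where "wdeg w \<equiv> sum_list (map deg w)"

lemma
  shows antisym_r: "antisym r" and trans_r: "trans r"
    and total_r: "\<gamma> \<in> \<Gamma> \<Longrightarrow> \<delta> \<in> \<Gamma> \<Longrightarrow> \<gamma> = \<delta> \<or> \<delta> \<in> lower \<gamma> \<or> \<gamma> \<in> lower \<delta>"
  using linear_order by (auto simp: order_on_defs total_on_def)

lemma lower_pos: "lower \<gamma> \<subseteq> pos_homogeneous"
  using homogeneous by auto

lemma generator_nonzero: "\<gamma> \<in> \<Gamma> \<Longrightarrow> \<gamma> \<noteq> 0"
  using not_in_lower[of \<gamma>] subspace_0[OF subspace_Alg, of "{\<delta> \<in> \<Gamma>. (\<delta>, \<gamma>) \<in> r \<and> \<delta> \<noteq> \<gamma>}"] by auto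

lemma
  assumes "\<gamma> \<in> \<Gamma>"
  shows deg_pos: "0 < deg \<gamma>" and generator_gr: "\<gamma> \<in> gr (deg \<gamma>)"
proof -
  obtain n where "0 < n" "\<gamma> \<in> gr n"
    using homogeneous assms by (auto simp: pos_homogeneous_def)
  moreover from this have "deg \<gamma> = n" by (intro hdeg_eq generator_nonzero assms)
  ultimately show "0 < deg \<gamma>" "\<gamma> \<in> gr (deg \<gamma>)" by simp_all
qed

lemma word_gr: "set w \<subseteq> \<Gamma> \<Longrightarrow> prod_list w \<in> gr (wdeg w)"
  by (induction w) (auto intro: gr_one gr_mult generator_gr)

lemma monomial_word:
  "monomial X n y \<Longrightarrow> X \<subseteq> \<Gamma> \<Longrightarrow> \<exists>w. set w \<subseteq> X \<and> wdeg w = n \<and> y = prod_list w"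
proof (induction rule: monomial.induct)
  case monomial_one
  show ?case by (intro exI[of _ "[]"]) simp
next
  case (monomial_step x i j y)
  then obtain w where "set w \<subseteq> X" "wdeg w = j" "y = prod_list w" by blast
  moreover have "deg x = i" using monomial_step by (intro hdeg_eq generator_nonzero) auto
  ultimately show ?case using monomial_step.hyps by (intro exI[of _ "x # w"]) auto
qed

lemma wdeg_mset: "mset v = mset w \<Longrightarrow> wdeg v = wdeg w"
  by (metis mset_map sum_mset_sum_list)

lemma deg_le_wdeg: "x \<in> set w \<Longrightarrow> deg x \<le> wdeg w"
  by (induction w) auto

lemma length_le_wdeg: "set w \<subseteq> \<Gamma> \<Longrightarrow> length w \<le> wdeg w"
proof (induction w)
  case (Cons x w)
  then show ?case using deg_pos[of x] by auto
qed simp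

lemma generator_below: "\<gamma> \<in> \<Gamma> \<Longrightarrow> deg \<gamma> \<le> d \<Longrightarrow> \<gamma> \<in> below (Suc d)"
  using gr_subset_below[of "deg \<gamma>" "Suc d"] deg_pos generator_gr by auto

section \<open>Spanning\<close>

abbreviation ordered_products :: "nat \<Rightarrow> 'h set" where
  "ordered_products d \<equiv> prod_list ` {w \<in> ordered_words \<Gamma> r. wdeg w = d}"

text \<open>
  Exchanging two adjacent letters of a word changes its value by a combination of words in which
  the two have been replaced by letters smaller than the larger one. The multiset of letters drops in
  the multiset extension of the order, which is well-founded in bounded degree.
\<close>

lemma word_in_span:
  assumes "set w \<subseteq> \<Gamma>" "wdeg w = d"
  shows "prod_list w \<in> span (ordered_products d)"
proof -
  let ?S = "span (ordered_products d)"
  define R where "R = {(\<delta>, \<gamma>). \<gamma> \<in> \<Gamma> \<inter> below (Suc d) \<and> \<delta> \<in> lower \<gamma> \<inter> below (Suc d)}"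
  have "wf (mult R)" unfolding R_def by (rule wf_mult[OF wf_below])
  then show ?thesis
    using assms
  proof (induction "mset w" arbitrary: w rule: wf_induct_rule)
    case less
    have good: "set v \<subseteq> \<Gamma>" "wdeg v = d" if "mset v = mset w" for v
    proof -
      show "set v \<subseteq> \<Gamma>" using less.prems(1) mset_eq_setD[OF that] by blast
      show "wdeg v = d" using less.prems(2) wdeg_mset[OF that] by (rule trans[rotated])
    qed
    (* The letters of a word in the commutator are smaller than \<gamma>, and of degree at most d. *)
    have lower_swap: "prod_list (u @ [\<gamma>, \<delta>] @ v) - prod_list (u @ [\<delta>, \<gamma>] @ v) \<in> ?S"
      if "mset (u @ [\<gamma>, \<delta>] @ v) = mset w" and \<delta>: "\<delta> \<in> lower \<gamma>" for u v \<gamma> \<delta>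
    proof -
      have G: "set (u @ [\<gamma>, \<delta>] @ v) \<subseteq> \<Gamma>" and d: "wdeg (u @ [\<gamma>, \<delta>] @ v) = d"
        using good[OF that(1)] by auto
      then have \<gamma>: "\<gamma> \<in> \<Gamma>" by simp
      let ?n = "deg \<gamma> + deg \<delta>"
      have "\<gamma> * \<delta> - \<delta> * \<gamma> \<in> Alg (lower \<gamma>)" using triangular_commutator \<gamma> \<delta> by blast
      moreover have "\<gamma> * \<delta> - \<delta> * \<gamma> \<in> gr ?n"
        using \<delta> by (intro commutator_in_gr[OF generator_gr[OF \<gamma>] generator_gr]) auto
      ultimately have "\<gamma> * \<delta> - \<delta> * \<gamma> \<in> span {y. monomial (lower \<gamma>) ?n y}"
        using Alg_gr_monomials[OF lower_pos] by blast
      then have "prod_list u * (\<gamma> * \<delta> - \<delta> * \<gamma>) * prod_list v \<in> ?S"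
      proof (induction rule: span_induct_alt)
        case (step c x y)
        then obtain x' where x': "set x' \<subseteq> lower \<gamma>" "wdeg x' = ?n" "x = prod_list x'"
          using monomial_word[of "lower \<gamma>" ?n x] by auto
        have "(mset x' + mset (u @ v), mset (u @ v) + {#\<gamma>, \<delta>#}) \<in> mult R"
        proof (subst add.commute, rule one_step_implies_mult)
          have "(z, \<gamma>) \<in> R" if z: "z \<in> set x'" for z
          proof -
            have "z \<in> \<Gamma>" "z \<in> lower \<gamma>" using z x' by auto
            moreover have "deg z \<le> d" using deg_le_wdeg[OF z] x'(2) d by simp
            moreover have "deg \<gamma> \<le> d" using d by simp
            ultimately show ?thesis using generator_below \<gamma> by (simp add: R_def)
          qed
          then show "\<forall>k\<in>set_mset (mset x'). \<exists>j\<in>set_mset {#\<gamma>, \<delta>#}. (k, j) \<in> R" by simp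
        qed simp
        then have "(mset (u @ x' @ v), mset w) \<in> mult R"
          using that(1) by (simp add: ac_simps flip: that(1))
        moreover have "set (u @ x' @ v) \<subseteq> \<Gamma>" "wdeg (u @ x' @ v) = d" using G d x' by auto
        ultimately have "prod_list (u @ x' @ v) \<in> ?S" by (rule less.hyps)
        then have "scale c (prod_list (u @ x' @ v)) + prod_list u * y * prod_list v \<in> ?S"
          by (intro span_add span_scale step)
        then show ?case
          by (simp add: x' distrib_left distrib_right scale_mult_left scale_mult_right mult.assoc)
      qed (simp add: span_zero)
      then show ?thesis by (simp add: algebra_simps)
    qed
    have swap: "prod_list (u @ [\<gamma>, \<delta>] @ v) - prod_list (u @ [\<delta>, \<gamma>] @ v) \<in> ?S"
      if m: "mset (u @ [\<gamma>, \<delta>] @ v) = mset w" for u v \<gamma> \<delta>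
    proof -
      have "\<gamma> \<in> \<Gamma>" "\<delta> \<in> \<Gamma>" using good[OF m] by auto
      then consider "\<gamma> = \<delta>" | "\<delta> \<in> lower \<gamma>" | "\<gamma> \<in> lower \<delta>" using total_r by blast
      then show ?thesis
      proof cases
        case 1
        then show ?thesis by (simp add: span_zero)
      next
        case 2
        show ?thesis by (rule lower_swap[OF m 2])
      next
        case 3
        then have "prod_list (u @ [\<delta>, \<gamma>] @ v) - prod_list (u @ [\<gamma>, \<delta>] @ v) \<in> ?S"
          using m by (intro lower_swap) (simp_all add: add_mset_commute)
        from span_neg[OF this] show ?thesis by simp
      qed
    qed
    have move: "prod_list (u @ p @ [a] @ v) - prod_list (u @ [a] @ p @ v) \<in> ?S"
      if "mset (u @ p @ [a] @ v) = mset w" for u p a v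
      using that
    proof (induction p arbitrary: v rule: rev_induct)
      case (snoc b p)
      have 1: "prod_list ((u @ p) @ [b, a] @ v) - prod_list ((u @ p) @ [a, b] @ v) \<in> ?S"
        using snoc.prems by (intro swap) simp
      have 2: "prod_list (u @ p @ [a] @ ([b] @ v)) - prod_list (u @ [a] @ p @ ([b] @ v)) \<in> ?S"
        using snoc.prems by (intro snoc.IH) (simp add: add_mset_commute)
      show ?case using span_add[OF 1 2] by simp
    qed (simp add: span_zero)
    (* Bring the first letter of xs to the front of ys, and recurse on the rest. *)
    have perm: "prod_list (u @ xs) - prod_list (u @ ys) \<in> ?S"
      if "mset (u @ xs) = mset w" "mset xs = mset ys" for u xs ys
      using that
    proof (induction xs arbitrary: u ys)
      case (Cons a xs)
      then obtain p q where ys: "ys = p @ a # q"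
        by (metis list.set_intros(1) set_mset_mset split_list)
      have 1: "prod_list ((u @ [a]) @ xs) - prod_list ((u @ [a]) @ (p @ q)) \<in> ?S"
        using Cons.prems ys by (intro Cons.IH) auto
      have 2: "prod_list (u @ p @ [a] @ q) - prod_list (u @ [a] @ p @ q) \<in> ?S"
        using Cons.prems ys by (intro move) auto
      show ?case using span_diff[OF 1 2] ys by simp
    qed (simp add: span_zero)
    obtain w' where w': "w' \<in> ordered_words \<Gamma> r" "mset w' = mset w"
      using ordered_word_of_mset[OF linear_order less.prems(1)] .
    have 1: "prod_list w' \<in> ?S" 
      by (intro span_base imageI CollectI conjI w'(1) good w'(2))
    have 2: "prod_list w - prod_list w' \<in> ?S" 
      using perm[of "[]" w w', OF _ w'(2)[symmetric]] by simp
    show ?case using span_add[OF 2 1] by simp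
  qed
qed

lemma gr_in_span:
  assumes "x \<in> gr n"
  shows "x \<in> span (ordered_products n)"
proof -
  have "x \<in> span {y. monomial \<Gamma> n y}"
    using Alg_gr_monomials[OF homogeneous _ assms] generate by simp
  moreover have "{y. monomial \<Gamma> n y} \<subseteq> span (ordered_products n)"
    using monomial_word[of \<Gamma> n] word_in_span by blast
  ultimately show ?thesis using span_minimal[OF _ subspace_span] by blast
qed

lemma span_ordered_words: "span (prod_list ` ordered_words \<Gamma> r) = UNIV"
proof -
  have "hcomp n x \<in> span (prod_list ` ordered_words \<Gamma> r)" for n x
    using gr_in_span[OF hcomp_in_gr] span_mono[of "ordered_products n" "prod_list ` ordered_words \<Gamma> r"]
    by blast
  then have "x \<in> span (prod_list ` ordered_words \<Gamma> r)" for x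
    by (rule in_subspace_if_hcomp[OF subspace_span])
  then show ?thesis by blast
qed

end

section \<open>Independence\<close>

lemma (in vector_space) separating_functional:
  assumes S: "subspace S" and x: "x \<notin> S"
  obtains \<phi> where "Vector_Spaces.linear scale (*) \<phi>" "\<And>y. y \<in> S \<Longrightarrow> \<phi> y = 0" "\<phi> x = 1"
proof -
  interpret vector_space_pair scale "(*)"
    by unfold_locales (auto simp: algebra_simps)
  obtain B where B: "B \<subseteq> S" "independent B" "S \<subseteq> span B"
    using maximal_independent_subset[of S] by blast
  have "x \<notin> span B" using span_minimal[OF B(1) S] x by blast
  then have "independent (insert x B)" using B(2) by (rule independent_insertI)
  from linear_independent_extend[OF this, of "\<lambda>y. if y = x then 1 else 0"]
  obtain \<phi> where \<phi>: "Vector_Spaces.linear scale (*) \<phi>"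
    "\<forall>y\<in>insert x B. \<phi> y = (if y = x then 1 else 0)" by blast
  have "\<phi> b = 0" if "b \<in> B" for b using that \<phi>(2) B(1) x by auto
  then have "\<phi> y = 0" if "y \<in> S" for y
    using linear_eq_0_on_span[OF \<phi>(1)] B(3) that by blast
  then show thesis using that \<phi> by simp
qed

context pbw_generators
begin

abbreviation up_to :: "'h \<Rightarrow> 'h set" where
  "up_to \<gamma> \<equiv> insert \<gamma> (lower \<gamma>)"

lemma comult_closed_Alg_down_closed:
  assumes "\<And>\<delta>. \<delta> \<in> X \<Longrightarrow> \<delta> \<in> \<Gamma> \<and> lower \<delta> \<subseteq> X"
  shows "comult_closed (Alg X)"
proof (rule comult_closed_Alg)
  fix \<delta> assume \<delta>: "\<delta> \<in> X"
  then have "Alg (lower \<delta>) \<subseteq> Alg X" using assms by (intro Alg_mono) blast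
  then have "tensor2_span scale (positive_pairs (Alg (lower \<delta>)) (deg \<delta>)) \<subseteq>
      tensor2_span scale (Alg X \<times> Alg X)"
    by (intro tensor2_span_mono positive_pairs_subset) blast
  then have 1: "comult \<delta> - primitive_part \<delta> \<in> tensor2_span scale (Alg X \<times> Alg X)"
    using triangular_comult assms[OF \<delta>] by blast
  have 2: "primitive_part \<delta> \<in> tensor2_span scale (Alg X \<times> Alg X)"
    using \<delta> by (intro tensor2_span_add pure2_in_tensor2_span) (auto intro: Alg_one Alg_base)
  show "comult \<delta> \<in> tensor2_span scale (Alg X \<times> Alg X)"
    using tensor2_span_add[OF 1 2] by simp
qed

lemma lower_mono: "(\<delta>, \<gamma>) \<in> r \<Longrightarrow> lower \<delta> \<subseteq> lower \<gamma>"
  using trans_r antisym_r by (auto dest: transD antisymD)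

lemma comult_closed_Alg_lower: "comult_closed (Alg (lower \<gamma>))"
  by (rule comult_closed_Alg_down_closed) (use lower_mono[of _ \<gamma>] in blast)

lemma comult_closed_Alg_up_to: "\<gamma> \<in> \<Gamma> \<Longrightarrow> comult_closed (Alg (up_to \<gamma>))"
  by (rule comult_closed_Alg_down_closed) (use lower_mono[of _ \<gamma>] in blast)

text \<open>
  A word whose degree is below that of \<open>\<gamma>\<close> has no room for the letter \<open>\<gamma>\<close>.
\<close>

lemma Alg_up_to_below:
  assumes \<gamma>: "\<gamma> \<in> \<Gamma>" and x: "x \<in> Alg (up_to \<gamma>)" "x \<in> gr i" "i < deg \<gamma>"
  shows "x \<in> Alg (lower \<gamma>)"
proof -
  have "\<gamma> \<notin> below (deg \<gamma>)"
    using gr_unique[OF generator_gr[OF \<gamma>] _ generator_nonzero[OF \<gamma>]] by (auto simp: below_def)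
  then have "up_to \<gamma> \<inter> below (deg \<gamma>) \<subseteq> lower \<gamma>" by auto
  moreover have "up_to \<gamma> \<subseteq> pos_homogeneous" using homogeneous \<gamma> by auto
  ultimately show ?thesis using Alg_gr_below[OF _ x] Alg_mono by blast
qed

definition functional_at :: "'h \<Rightarrow> ('h \<Rightarrow> 'k) \<Rightarrow> bool" where
  "functional_at \<gamma> \<phi> \<longleftrightarrow> Vector_Spaces.linear scale (*) \<phi> \<and> \<phi> \<gamma> = 1 \<and> \<phi> 1 = 0 \<and>
     (\<forall>x\<in>Alg (lower \<gamma>). \<phi> x = 0) \<and>
     (\<forall>x\<in>Alg (up_to \<gamma>). \<forall>y\<in>Alg (up_to \<gamma>). \<phi> (x * y) = counit x * \<phi> y + \<phi> x * counit y)"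

definition derivation_at :: "'h \<Rightarrow> ('h \<Rightarrow> 'h) \<Rightarrow> bool" where
  "derivation_at \<gamma> D \<longleftrightarrow> Vector_Spaces.linear scale scale D \<and> D \<gamma> = 1 \<and>
     (\<forall>x\<in>Alg (lower \<gamma>). D x = 0) \<and>
     (\<forall>x\<in>Alg (up_to \<gamma>). \<forall>y\<in>Alg (up_to \<gamma>). D (x * y) = x * D y + D x * y)"

text \<open>
  A linear form that vanishes on the lower subalgebra and in all degrees but that of \<open>\<gamma>\<close> kills
  products of positive-degree elements of \<open>Alg (up_to \<gamma>)\<close>, since the factors of a product of the
  degree of \<open>\<gamma>\<close> lie in the lower subalgebra. Hence it is a derivation at the counit there.
\<close>

lemma functional_at_generator:
  assumes \<gamma>: "\<gamma> \<in> \<Gamma>"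
  obtains \<phi> where "functional_at \<gamma> \<phi>"
proof -
  let ?K = "Alg (lower \<gamma>)" and ?L = "Alg (up_to \<gamma>)" and ?n = "deg \<gamma>"
  obtain \<psi> where \<psi>: "Vector_Spaces.linear scale (*) \<psi>" "\<And>y. y \<in> ?K \<Longrightarrow> \<psi> y = 0" "\<psi> \<gamma> = 1"
    using separating_functional[OF subspace_Alg not_in_lower[OF \<gamma>]] by blast
  define \<phi> where "\<phi> = (\<lambda>x. \<psi> (hcomp ?n x))"
  interpret psi: Vector_Spaces.linear scale "(*)" \<psi> by (rule \<psi>(1))
  have lin: "Vector_Spaces.linear scale (*) \<phi>"
    using psi.linear_axioms linear_hcomp unfolding Vector_Spaces.linear_iff \<phi>_def by auto
  interpret phi: Vector_Spaces.linear scale "(*)" \<phi> by (rule lin)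
  have K: "graded_subspace ?K" by (rule graded_Alg[OF lower_pos])
  have L: "graded_subspace ?L" using homogeneous \<gamma> by (intro graded_Alg) auto
  have gr: "\<phi> x = 0" if "x \<in> gr m" "m \<noteq> ?n" for x m
    using that by (simp add: \<phi>_def hcomp_gr psi.zero)
  have K0: "\<phi> x = 0" if "x \<in> ?K" for x
    using that K \<psi>(2) by (auto simp: \<phi>_def graded_subspace_def)
  have one: "\<phi> 1 = 0" by (rule K0[OF Alg_one])
  have prod0: "\<phi> (x * y) = 0"
    if x: "x \<in> ?L" "hcomp 0 x = 0" and y: "y \<in> ?L" "hcomp 0 y = 0" for x y
  proof -
    have "\<phi> (hcomp i x * hcomp j y) = 0" for i j
    proof (cases "i = 0 \<or> j = 0 \<or> i + j \<noteq> ?n")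
      case True
      then show ?thesis
        using x y gr[OF gr_mult[OF hcomp_in_gr hcomp_in_gr]] by (auto simp: phi.zero)
    next
      case False
      then have "hcomp i x \<in> ?K" "hcomp j y \<in> ?K"
        using x y L by (auto intro!: Alg_up_to_below[OF \<gamma> _ hcomp_in_gr] simp: graded_subspace_def)
      then show ?thesis by (intro K0 Alg_mult)
    qed
    then have "\<phi> ((\<Sum>i | hcomp i x \<noteq> 0. hcomp i x) * (\<Sum>j | hcomp j y \<noteq> 0. hcomp j y)) = 0"
      by (simp add: sum_product phi.sum)
    then show ?thesis by (simp add: sum_hcomp)
  qed
  have deriv: "\<phi> (x * y) = counit x * \<phi> y + \<phi> x * counit y" if "x \<in> ?L" "y \<in> ?L" for x y
  proof -
    (* Subtracting the components of degree 0 reduces to elements without constant term. *)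
    define x' y' where "x' = x - scale (counit x) 1" and "y' = y - scale (counit y) 1"
    have sub: "z - scale (counit z) 1 \<in> ?L" "hcomp 0 (z - scale (counit z) 1) = 0" if "z \<in> ?L" for z
    proof -
      show "z - scale (counit z) 1 \<in> ?L"
        using that by (intro subspace_diff[OF subspace_Alg] subspace_scale[OF subspace_Alg] Alg_one)
      have "hcomp 0 ((z - scale (counit z) 1) + scale (counit z) 1) =
          hcomp 0 (z - scale (counit z) 1) + hcomp 0 (scale (counit z) 1)"
        by (rule hcomp_add)
      moreover have "hcomp 0 (scale (counit z) 1) = scale (counit z) 1"
        using hcomp_gr[OF gr_one] by (simp add: hcomp_scale)
      ultimately show "hcomp 0 (z - scale (counit z) 1) = 0" by (simp add: counit_hcomp)
    qed
    have "\<phi> (x' * y') = 0" unfolding x'_def y'_def using that by (intro prod0 sub)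
    moreover have "x * y = scale (counit x) y + scale (counit y) x' + x' * y'"
      by (simp add: x'_def y'_def algebra_simps scale_mult_left scale_mult_right)
    moreover have "\<phi> x' = \<phi> x" by (simp add: x'_def phi.diff phi.scale one)
    ultimately show ?thesis by (simp add: phi.add phi.scale)
  qed
  have "\<phi> \<gamma> = 1" using \<psi>(3) hcomp_gr[OF generator_gr[OF \<gamma>]] by (simp add: \<phi>_def)
  then have "functional_at \<gamma> \<phi>" using lin one K0 deriv by (simp add: functional_at_def)
  then show thesis by (rule that)
qed

text \<open>
  The derivation is \<open>D = (id \<otimes> \<phi>) \<circ> \<Delta>\<close>. As \<open>\<Delta>\<close> is multiplicative and \<open>\<phi>\<close> is a derivation at
  the counit, \<open>D (x y) = x\<^sub>1 y\<^sub>1 \<phi>(x\<^sub>2 y\<^sub>2) = x D y + D x y\<close>.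
\<close>

lemma derivation_at_generator:
  assumes \<gamma>: "\<gamma> \<in> \<Gamma>"
  obtains D where "derivation_at \<gamma> D"
proof -
  let ?K = "Alg (lower \<gamma>)" and ?L = "Alg (up_to \<gamma>)"
  obtain \<phi> where "functional_at \<gamma> \<phi>" using functional_at_generator[OF \<gamma>] .
  then have \<phi>: "Vector_Spaces.linear scale (*) \<phi>" "\<phi> \<gamma> = 1" "\<phi> 1 = 0"
    "\<And>x. x \<in> ?K \<Longrightarrow> \<phi> x = 0"
    "\<And>x y. x \<in> ?L \<Longrightarrow> y \<in> ?L \<Longrightarrow> \<phi> (x * y) = counit x * \<phi> y + \<phi> x * counit y"
    by (simp_all add: functional_at_def)
  (* The map id (x) \<psi> on representatives of tensors. *)
  define conv where "conv \<psi> = free_lift scale (\<lambda>(a, b). scale (\<psi> b) a)" for \<psi> :: "'h \<Rightarrow> 'k"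
  have conv_rels: "conv \<psi> p = 0" if "Vector_Spaces.linear scale (*) \<psi>" "p \<in> bilinear_rels scale" for \<psi> p
  proof -
    interpret psi: Vector_Spaces.linear scale "(*)" \<psi> by (rule that(1))
    have "conv \<psi> p \<in> {0}"
      unfolding conv_def
      by (rule free_lift_bilinear_rels[OF subspace_single_0 that(2)])
         (simp_all add: psi.add psi.scale scale_left_distrib scale_right_distrib mult.commute)
    then show ?thesis by simp
  qed
  have conv_cong: "conv \<psi> p = conv \<psi> q"
    if "Vector_Spaces.linear scale (*) \<psi>" "tensor2_eq scale p q" for \<psi> p q
    using conv_rels[OF that(1), of "p - q"] that(2)
    by (simp add: tensor2_eq_def conv_def free_lift_diff)
  have conv_pure: "conv \<psi> (pure2 a b) = scale (\<psi> b) a" for \<psi> a b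
    by (simp add: conv_def free_lift_pure2)
  have conv_lin: "conv \<psi> (p + q) = conv \<psi> p + conv \<psi> q" "conv \<psi> (p - q) = conv \<psi> p - conv \<psi> q"
    "conv \<psi> (fscale c p) = scale c (conv \<psi> p)" for \<psi> p q c
    by (simp_all add: conv_def free_lift_add free_lift_diff free_lift_fscale)
  have conv_counit: "conv counit (comult x) = x" for x
    unfolding conv_def by (rule counit_right)
  define D where "D x = conv \<phi> (comult x)" for x
  have D_lin: "Vector_Spaces.linear scale scale D"
    using conv_cong[OF \<phi>(1) comult_add] conv_cong[OF \<phi>(1) comult_scale]
    by (intro Vector_Spaces.linear_iff[THEN iffD2] conjI allI vector_space_axioms)
       (simp_all add: D_def conv_lin)
  have K0: "conv \<phi> p = 0" if "p \<in> tensor2_span scale (?K \<times> ?K)" for p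
  proof -
    have "conv \<phi> p \<in> {0}"
    proof (rule tensor2_span_linear_image[OF _ that subspace_single_0])
      show "Vector_Spaces.linear fscale scale (conv \<phi>)"
        unfolding conv_def by (rule linear_free_lift)
      show "conv \<phi> q \<in> {0}" if "q \<in> bilinear_rels scale" for q
        using conv_rels[OF \<phi>(1) that] by simp
    qed (simp add: conv_pure \<phi>(4))
    then show ?thesis by simp
  qed
  have "positive_pairs ?K (deg \<gamma>) \<subseteq> ?K \<times> ?K" by (rule positive_pairs_subset) blast
  then have "comult \<gamma> - primitive_part \<gamma> \<in> tensor2_span scale (?K \<times> ?K)"
    using triangular_comult[OF \<gamma>] tensor2_span_mono by blast
  from K0[OF this] have D_gen: "D \<gamma> = 1"
    by (simp add: D_def conv_lin conv_pure \<phi>(2,3))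
  have D_lower: "D x = 0" if "x \<in> ?K" for x
    using comult_closed_Alg_lower that unfolding D_def comult_closed_def by (blast intro: K0)
  (* The failure of the Leibniz rule; it is bilinear, so it vanishes as soon as it does on pure tensors. *)
  define G where "G p q = conv \<phi> (tensor2_mult p q) -
      (conv counit p * conv \<phi> q + conv \<phi> p * conv counit q)" for p q
  have G_lin: "Vector_Spaces.linear fscale scale (\<lambda>p. G p q)" "Vector_Spaces.linear fscale scale (G p)"
    for p q
    by (intro Vector_Spaces.linear_iff[THEN iffD2] conjI allI vector_space_axioms vector_space_fscale;
        simp add: G_def conv_lin tensor2_mult_add_left tensor2_mult_add_right
          tensor2_mult_fscale_left tensor2_mult_fscale_right scale_mult_left scale_mult_right
          algebra_simps)+
  have G_rels: "G p q = 0" if "p \<in> bilinear_rels scale \<or> q \<in> bilinear_rels scale" for p q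
    using that conv_rels[OF \<phi>(1)] conv_rels[OF counit_linear]
      tensor2_mult_rels_left tensor2_mult_rels_right by (auto simp: G_def)
  have G0: "G p q = 0"
    if p: "p \<in> tensor2_span scale (?L \<times> ?L)" and q: "q \<in> tensor2_span scale (?L \<times> ?L)" for p q
  proof -
    have "G p q \<in> {0}"
    proof (rule tensor2_span_linear_image[OF G_lin(1) p subspace_single_0])
      fix a b assume ab: "(a, b) \<in> ?L \<times> ?L"
      show "G (pure2 a b) q \<in> {0}"
      proof (rule tensor2_span_linear_image[OF G_lin(2) q subspace_single_0])
        fix c d assume "(c, d) \<in> ?L \<times> ?L"
        then show "G (pure2 a b) (pure2 c d) \<in> {0}"
          using ab by (simp add: G_def tensor2_mult_pure2 conv_pure \<phi>(5) scale_mult_left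
              scale_mult_right scale_left_distrib mult.commute)
      qed (simp add: G_rels)
    qed (simp add: G_rels)
    then show ?thesis by simp
  qed
  have "D (x * y) = x * D y + D x * y" if "x \<in> ?L" "y \<in> ?L" for x y
  proof -
    have "G (comult x) (comult y) = 0"
      using comult_closed_Alg_up_to[OF \<gamma>] that unfolding comult_closed_def by (blast intro: G0)
    then show ?thesis
      using conv_cong[OF \<phi>(1) comult_mult[of x y]] by (simp add: G_def conv_counit D_def)
  qed
  with D_lin D_gen D_lower have "derivation_at \<gamma> D" by (simp add: derivation_at_def)
  then show thesis by (rule that)
qed

lemma derivation_power:
  assumes \<gamma>: "\<gamma> \<in> \<Gamma>" and a: "a \<in> Alg (lower \<gamma>)"
    and D: "derivation_at \<gamma> D"
  shows "D (a * \<gamma> ^ i) = scale (of_nat i) (a * \<gamma> ^ (i - 1))"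
proof -
  have low: "D x = 0" if "x \<in> Alg (lower \<gamma>)" for x using D that by (simp add: derivation_at_def)
  have prod: "D (x * y) = x * D y + D x * y" if "x \<in> Alg (up_to \<gamma>)" "y \<in> Alg (up_to \<gamma>)" for x y
    using D that by (simp add: derivation_at_def)
  have pow: "\<gamma> ^ i \<in> Alg (up_to \<gamma>)" for i
    by (induction i) (auto intro: Alg_one Alg_mult Alg_base)
  have "D (\<gamma> ^ i) = scale (of_nat i) (\<gamma> ^ (i - 1))" for i
  proof (induction i)
    case 0
    then show ?case using low[OF Alg_one] by simp
  next
    case (Suc i)
    have "D (\<gamma> ^ Suc i) = \<gamma> * D (\<gamma> ^ i) + \<gamma> ^ i"
      using prod[OF Alg_base pow, of \<gamma> i] D by (simp add: derivation_at_def)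
    also have "\<gamma> * D (\<gamma> ^ i) = scale (of_nat i) (\<gamma> ^ i)"
      unfolding Suc.IH by (cases i) (simp_all add: scale_mult_right)
    finally show ?case by (simp add: scale_left_distrib)
  qed
  moreover have "a \<in> Alg (up_to \<gamma>)" using a Alg_mono[of "lower \<gamma>" "up_to \<gamma>"] by blast
  ultimately show ?thesis
    using prod[OF _ pow, of a i] low[OF a] by (simp add: scale_mult_right)
qed

lemma ordered_word_split:
  assumes "w \<in> ordered_words \<Gamma> r" "\<forall>x\<in>set w. (x, \<gamma>) \<in> r"
  obtains u i where "w = u @ replicate i \<gamma>" "set u \<subseteq> lower \<gamma>"
proof -
  have "\<exists>u i. w = u @ replicate i \<gamma> \<and> set u \<subseteq> lower \<gamma>"
    using assms
  proof (induction w rule: rev_induct)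
    case (snoc x w)
    show ?case
    proof (cases "x = \<gamma>")
      case True
      have "w \<in> ordered_words \<Gamma> r" using snoc.prems by (auto simp: ordered_words_def sorted_wrt_append)
      with snoc obtain u i where "w = u @ replicate i \<gamma>" "set u \<subseteq> lower \<gamma>" by auto
      then show ?thesis
        using True by (intro exI[of _ u] exI[of _ "Suc i"]) (simp add: replicate_append_same)
    next
      case False
      have "y \<in> lower \<gamma>" if "y \<in> set (w @ [x])" for y
        using snoc.prems that False antisymD[OF antisym_r, of \<gamma> x]
        by (auto simp: ordered_words_def sorted_wrt_append)
      then show ?thesis by (intro exI[of _ "w @ [x]"] exI[of _ 0]) auto
    qed
  qed simp
  then show thesis using that by blast
qed

lemma prod_list_in_Alg: "set w \<subseteq> X \<Longrightarrow> prod_list w \<in> Alg X"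
  by (induction w) (auto intro: Alg_one Alg_mult Alg_base)

text \<open>
  Applying the derivation at the largest letter that occurs removes one copy of it from every
  word, at the price of a factor that is nonzero in characteristic zero.
\<close>

lemma ordered_words_independent:
  assumes "finite F" "F \<subseteq> ordered_words \<Gamma> r" "\<And>w. w \<in> F \<Longrightarrow> c w \<noteq> 0"
    and "(\<Sum>w\<in>F. scale (c w) (prod_list w)) = 0"
  shows "F = {}"
  using assms
proof (induction "\<Sum>w\<in>F. length w" arbitrary: F c rule: less_induct)
  case less
  show ?case
  proof (rule ccontr)
    assume F: "F \<noteq> {}"
    let ?A = "\<Union>(set ` F)"
    have A: "finite ?A" "?A \<subseteq> \<Gamma>" using less.prems(1,2) by (auto simp: ordered_words_def)
    show False
    proof (cases "?A = {}")
      case True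
      then have "w = []" if "w \<in> F" for w using that by simp
      then have F0: "F = {[]}" using F by blast
      then have "scale (c []) 1 = 0" using less.prems(4) by simp
      moreover have "c [] \<noteq> 0" using less.prems(3) F0 by blast
      ultimately show False by simp
    next
      case False
      obtain \<gamma> where \<gamma>: "\<gamma> \<in> ?A" "\<forall>x\<in>?A. (x, \<gamma>) \<in> r"
        using finite_linear_order_max[OF linear_order A(1) False A(2)] .
      then have \<gamma>\<Gamma>: "\<gamma> \<in> \<Gamma>" using A(2) by blast
      obtain D where D: "derivation_at \<gamma> D" using derivation_at_generator[OF \<gamma>\<Gamma>] .
      interpret D: Vector_Spaces.linear scale scale D using D by (simp add: derivation_at_def)
      have split: "\<exists>u i. w = u @ replicate i \<gamma> \<and> set u \<subseteq> lower \<gamma>" if "w \<in> F" for w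
      proof -
        have "w \<in> ordered_words \<Gamma> r" "\<forall>x\<in>set w. (x, \<gamma>) \<in> r" using less.prems(2) \<gamma>(2) that by auto
        then show ?thesis by (rule ordered_word_split) blast
      qed
      have Dw: "D (prod_list w) = scale (of_nat (count_list w \<gamma>)) (prod_list (butlast w))"
        if wF: "w \<in> F" for w
      proof -
        obtain u i where w: "w = u @ replicate i \<gamma>" "set u \<subseteq> lower \<gamma>" using split[OF wF] by blast
        have "count_list u \<gamma> = 0" using w(2) by (auto simp: count_list_0_iff)
        moreover have "count_list (replicate i \<gamma>) \<gamma> = i" by (induction i) simp_all
        moreover have "butlast w = u @ replicate (i - 1) \<gamma>" if i: "i \<noteq> 0"
        proof -
          have "replicate i \<gamma> = replicate (i - 1) \<gamma> @ [\<gamma>]"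
            using i by (cases i) (simp_all add: replicate_append_same)
          then show ?thesis using w(1) by (simp add: butlast_append)
        qed
        moreover have "D (prod_list w) = scale (of_nat i) (prod_list u * \<gamma> ^ (i - 1))"
          using derivation_power[OF \<gamma>\<Gamma> prod_list_in_Alg[OF w(2)] D] w(1)
          by simp
        ultimately show ?thesis
          using w(1) by (cases "i = 0") simp_all
      qed
      (* Only the words that contain \<gamma> survive, and they end in \<gamma>. *)
      define F1 where "F1 = {w \<in> F. \<gamma> \<in> set w}"
      have F1: "finite F1" "F1 \<subseteq> F" using less.prems(1) by (auto simp: F1_def)
      have last: "w = butlast w @ [\<gamma>]" if wF: "w \<in> F1" for w
      proof -
        obtain u i where w: "w = u @ replicate i \<gamma>" "set u \<subseteq> lower \<gamma>"
          using split[of w] wF F1 by blast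
        have "i \<noteq> 0" using wF w by (auto simp: F1_def)
        then have "last w = \<gamma>" "w \<noteq> []" using w(1) by simp_all
        then show ?thesis by (metis append_butlast_last_id)
      qed
      have inj: "inj_on butlast F1" by (rule inj_onI) (metis last)
      let ?c = "\<lambda>v. c (v @ [\<gamma>]) * of_nat (count_list (v @ [\<gamma>]) \<gamma>)"
      have "0 = D (\<Sum>w\<in>F. scale (c w) (prod_list w))" using less.prems(4) by (simp add: D.zero)
      also have "\<dots> = (\<Sum>w\<in>F. scale (c w * of_nat (count_list w \<gamma>)) (prod_list (butlast w)))"
        by (simp add: D.sum D.scale Dw)
      also have "\<dots> = (\<Sum>w\<in>F1. scale (c w * of_nat (count_list w \<gamma>)) (prod_list (butlast w)))"
        using less.prems(1)
        by (intro sum.mono_neutral_right) (auto simp: F1_def count_list_0_iff)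
      also have "\<dots> = (\<Sum>w\<in>F1. scale (?c (butlast w)) (prod_list (butlast w)))"
        by (rule sum.cong[OF refl]) (simp flip: last)
      also have "\<dots> = (\<Sum>v\<in>butlast ` F1. scale (?c v) (prod_list v))"
        by (simp add: sum.reindex[OF inj])
      finally have sum0: "(\<Sum>v\<in>butlast ` F1. scale (?c v) (prod_list v)) = 0" by simp
      obtain w where w: "w \<in> F1" using \<gamma>(1) by (auto simp: F1_def)
      have "(\<Sum>v\<in>butlast ` F1. length v) = (\<Sum>w\<in>F1. length w - 1)"
        by (simp add: sum.reindex[OF inj])
      also have "\<dots> < (\<Sum>w\<in>F1. length w)"
        using w F1(1) by (intro sum_strict_mono) (auto simp: F1_def dest: length_pos_if_in_set)
      also have "\<dots> \<le> (\<Sum>w\<in>F. length w)"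
        using less.prems(1) F1(2) by (intro sum_mono2) auto
      finally have "butlast ` F1 = {}"
      proof (rule less.hyps[OF _ _ _ _ sum0])
        show "finite (butlast ` F1)" using F1(1) by simp
        show "butlast ` F1 \<subseteq> ordered_words \<Gamma> r"
        proof clarify
          fix w assume "w \<in> F1"
          then have "butlast w @ [\<gamma>] \<in> ordered_words \<Gamma> r" using last F1(2) less.prems(2) by auto
          then show "butlast w \<in> ordered_words \<Gamma> r"
            by (auto simp: ordered_words_def sorted_wrt_append)
        qed
        show "?c v \<noteq> 0" if "v \<in> butlast ` F1" for v
        proof -
          have "v @ [\<gamma>] \<in> F" using that last F1(2) by (metis imageE subsetD)
          moreover have "(of_nat (count_list (v @ [\<gamma>]) \<gamma>) :: 'k) \<noteq> 0"
            unfolding of_nat_eq_0_iff by simp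
          ultimately show ?thesis using less.prems(3) by (metis mult_eq_0_iff)
        qed
      qed
      then show False using w by blast
    qed
  qed
qed

lemma inj_on_ordered_words: "inj_on prod_list (ordered_words \<Gamma> r)"
proof (rule inj_onI, rule ccontr)
  fix v w assume "v \<in> ordered_words \<Gamma> r" "w \<in> ordered_words \<Gamma> r"
    "prod_list v = prod_list w" "v \<noteq> w"
  then have "{v, w} = {}"
    by (intro ordered_words_independent[of _ "\<lambda>u. if u = v then 1 else - 1"]) auto
  then show False by simp
qed

lemma independent_ordered_words: "independent (prod_list ` ordered_words \<Gamma> r)"
  unfolding independent_explicit_module
proof (intro allI impI)
  fix t u v
  assume t: "finite t" "t \<subseteq> prod_list ` ordered_words \<Gamma> r" "(\<Sum>v\<in>t. scale (u v) v) = 0" "v \<in> t"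
  define F where "F = {w \<in> ordered_words \<Gamma> r. prod_list w \<in> t \<and> u (prod_list w) \<noteq> 0}"
  have inj: "inj_on prod_list F"
    by (rule inj_on_subset[OF inj_on_ordered_words]) (auto simp: F_def)
  have im: "prod_list ` F = {v \<in> t. u v \<noteq> 0}" using t(2) by (auto simp: F_def)
  have "finite F" by (rule finite_imageD[OF _ inj]) (simp add: im t(1))
  moreover have "(\<Sum>w\<in>F. scale (u (prod_list w)) (prod_list w)) = (\<Sum>v\<in>{v \<in> t. u v \<noteq> 0}. scale (u v) v)"
    by (simp add: sum.reindex[OF inj] flip: im)
  moreover have "\<dots> = (\<Sum>v\<in>t. scale (u v) v)"
    using t(1) by (intro sum.mono_neutral_left) auto
  ultimately have "F = {}"
    using t(3) by (intro ordered_words_independent[of F "\<lambda>w. u (prod_list w)"]) (auto simp: F_def)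
  then show "u v = 0" using im t(4) by blast
qed

end

section \<open>Growth\<close>

lemma tendsto_const_plus_div_ln:
  "(\<lambda>n. ereal (a + b / ln (real n))) \<longlonglongrightarrow> ereal a"
proof -
  have "filterlim (\<lambda>n. ln (real n)) at_top sequentially"
    by (rule filterlim_compose[OF ln_at_top filterlim_real_sequentially])
  then have "filterlim (\<lambda>n. ln (real n)) at_infinity sequentially"
    by (rule filterlim_at_top_imp_at_infinity)
  then have "(\<lambda>n. b / ln (real n)) \<longlonglongrightarrow> 0"
    by (rule tendsto_divide_0[OF tendsto_const])
  from tendsto_add[OF tendsto_const[of a] this] show ?thesis
    by (intro tendsto_ereal) simp
qed

text \<open>
  Constant factors are invisible to the logarithm in base \<open>n\<close>: they contribute a multiple of
  \<open>1 / ln n\<close>.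
\<close>

lemma limsup_log_le:
  assumes "\<And>n. 2 \<le> n \<Longrightarrow> real (g n) \<le> (real c * real n) ^ m" "0 < c"
  shows "limsup (\<lambda>n. ereal (log (real n) (real (g n)))) \<le> ereal (real m)"
proof -
  let ?h = "\<lambda>n. ereal (real m + real m * ln (real c) / ln (real n))"
  have "log (real n) (real (g n)) \<le> real m + real m * ln (real c) / ln (real n)"
    if n: "2 \<le> n" for n
  proof -
    have ln: "0 < ln (real n)" using n by simp
    have c: "0 \<le> ln (real c)" using assms(2) by simp
    have "ln (real (g n)) \<le> real m * ln (real c) + real m * ln (real n)"
    proof (cases "g n = 0")
      case True
      then show ?thesis using ln c by simp
    next
      case False
      then have "ln (real (g n)) \<le> ln ((real c * real n) ^ m)"
        using assms(1)[OF n] by (intro ln_mono) simp_all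
      also have "\<dots> = real m * ln (real c) + real m * ln (real n)"
        using assms(2) n by (simp add: ln_realpow ln_mult distrib_left)
      finally show ?thesis .
    qed
    then show ?thesis using ln by (simp add: log_def field_simps)
  qed
  then have "\<forall>\<^sub>F n in sequentially. ereal (log (real n) (real (g n))) \<le> ?h n"
    unfolding eventually_sequentially by (intro exI[of _ 2]) simp
  then have "limsup (\<lambda>n. ereal (log (real n) (real (g n)))) \<le> limsup ?h"
    by (rule Limsup_mono)
  also have "\<dots> = ereal (real m)"
    by (rule lim_imp_Limsup[OF trivial_limit_sequentially tendsto_const_plus_div_ln])
  finally show ?thesis .
qed

lemma limsup_log_ge:
  assumes "\<And>n. (n div m + 1) ^ m \<le> g n"
  shows "ereal (real m) \<le> limsup (\<lambda>n. ereal (log (real n) (real (g n))))"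
proof -
  let ?h = "\<lambda>n. ereal (real m + - (real m * ln (real m)) / ln (real n))"
  have "real m + - (real m * ln (real m)) / ln (real n) \<le> log (real n) (real (g n))"
    if n: "2 \<le> n" for n
  proof -
    have ln: "0 < ln (real n)" using n by simp
    have pos: "0 < (n div m + 1) ^ m" by simp
    have "real m * ln (real n) - real m * ln (real m) \<le> ln (real (g n))"
    proof (cases "m = 0")
      case True
      then show ?thesis using assms[of n] by simp
    next
      case False
      have "n \<le> m * (n div m + 1)"
        using dividend_less_times_div[of m n] False by simp
      then have "real n \<le> real m * real (n div m + 1)"
        by (metis of_nat_le_iff of_nat_mult)
      then have "real n / real m \<le> real (n div m + 1)"
        using False by (simp add: field_simps)
      then have "(real n / real m) ^ m \<le> real (n div m + 1) ^ m"
        by (intro power_mono) simp_all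
      also have "\<dots> \<le> real (g n)" using assms[of n] by (metis of_nat_le_iff of_nat_power)
      finally have "ln ((real n / real m) ^ m) \<le> ln (real (g n))"
        using n False by (intro ln_mono) simp_all
      then show ?thesis using n False by (simp add: ln_realpow ln_div right_diff_distrib)
    qed
    then have "(real m * ln (real n) - real m * ln (real m)) / ln (real n) \<le> ln (real (g n)) / ln (real n)"
      using ln by (intro divide_right_mono) simp_all
    then show ?thesis using ln by (simp add: log_def diff_divide_distrib)
  qed
  then have "\<forall>\<^sub>F n in sequentially. ?h n \<le> ereal (log (real n) (real (g n)))"
    unfolding eventually_sequentially by (intro exI[of _ 2]) simp
  then have "limsup ?h \<le> limsup (\<lambda>n. ereal (log (real n) (real (g n))))"
    by (rule Limsup_mono)
  moreover have "limsup ?h = ereal (real m)"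
    by (rule lim_imp_Limsup[OF trivial_limit_sequentially tendsto_const_plus_div_ln])
  ultimately show ?thesis by simp
qed

lemma (in k_algebra) span_mult:
  assumes x: "x \<in> span A" and y: "y \<in> span B" and T: "subspace T"
    and AB: "\<And>a b. a \<in> A \<Longrightarrow> b \<in> B \<Longrightarrow> a * b \<in> T"
  shows "x * y \<in> T"
proof -
  have "a * y \<in> T" if "a \<in> A" for a
    using y
  proof (induction rule: span_induct_alt)
    case (step c b y)
    then show ?case
      using T AB[OF that] by (simp add: distrib_left scale_mult_right subspace_add subspace_scale)
  qed (simp add: subspace_0[OF T])
  with x show ?thesis
  proof (induction rule: span_induct_alt)
    case (step c a x)
    then show ?case
      using T by (simp add: distrib_right scale_mult_left subspace_add subspace_scale)
  qed (simp add: subspace_0[OF T])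
qed

definition bounded_words :: "'i set \<Rightarrow> 'i rel \<Rightarrow> 'i set \<Rightarrow> nat \<Rightarrow> 'i list set" where
  "bounded_words I r S N = {w \<in> ordered_words I r. set w \<subseteq> S \<and> (\<forall>x. count (mset w) x \<le> N)}"

text \<open>
  An ordered word is determined by the multiplicities of its letters, which may be chosen freely.
\<close>

lemma bounded_words_card:
  assumes r: "linear_order_on I r" and S: "finite S" "S \<subseteq> I"
  shows "finite (bounded_words I r S N)" "card (bounded_words I r S N) = (N + 1) ^ card S"
proof -
  let ?f = "\<lambda>w. restrict (count (mset w)) S"
  have anti: "antisym r" using r by (simp add: order_on_defs)
  have "bij_betw ?f (bounded_words I r S N) (PiE S (\<lambda>_. {..N}))"
    unfolding bij_betw_def
  proof
    show "inj_on ?f (bounded_words I r S N)"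
    proof (rule inj_onI)
      fix v w assume vw: "v \<in> bounded_words I r S N" "w \<in> bounded_words I r S N" "?f v = ?f w"
      have "mset v = mset w"
      proof (rule multiset_eqI)
        fix x
        show "count (mset v) x = count (mset w) x"
        proof (cases "x \<in> S")
          case True
          then show ?thesis using fun_cong[OF vw(3), of x] by simp
        next
          case False
          then have "x \<notin> set v" "x \<notin> set w" using vw by (auto simp: bounded_words_def)
          then show ?thesis by (simp add: count_mset_0_iff[THEN iffD2])
        qed
      qed
      then show "v = w"
        using vw ordered_word_unique[OF anti] by (auto simp: bounded_words_def)
    qed
    show "?f ` bounded_words I r S N = PiE S (\<lambda>_. {..N})"
    proof (intro subset_antisym subsetI)
      fix f assume f: "f \<in> PiE S (\<lambda>_. {..N})"
      define M where "M = (\<Sum>x\<in>S. replicate_mset (f x) x)"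
      have count: "count M x = (if x \<in> S then f x else 0)" for x
        using S(1) by (simp add: M_def count_sum if_distrib[of "count _"] cong: if_cong)
      obtain xs where xs: "mset xs = M" using ex_mset by blast
      have sub: "set xs \<subseteq> S"
      proof
        fix x assume "x \<in> set xs"
        then have "x \<in># M" using xs by (metis set_mset_mset)
        then show "x \<in> S" using count[of x] by (auto simp: count_greater_zero_iff[symmetric] split: if_splits)
      qed
      then have "set xs \<subseteq> I" using S(2) by blast
      from ordered_word_of_mset[OF r this] obtain w
        where w: "w \<in> ordered_words I r" "mset w = mset xs" .
      have "set w = set xs" using w(2) by (rule mset_eq_setD)
      then have "w \<in> bounded_words I r S N"
        using w xs sub f count by (auto simp: bounded_words_def PiE_def)
      moreover have "?f w = f"
        using f w(2) xs count by (auto simp: PiE_def extensional_def restrict_def)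
      ultimately show "f \<in> ?f ` bounded_words I r S N" by blast
    qed (auto simp: bounded_words_def)
  qed
  moreover have "finite (PiE S (\<lambda>_. {..N}))" "card (PiE S (\<lambda>_. {..N})) = (N + 1) ^ card S"
    using S(1) by (simp_all add: finite_PiE card_PiE)
  ultimately show "finite (bounded_words I r S N)" "card (bounded_words I r S N) = (N + 1) ^ card S"
    using bij_betw_finite bij_betw_same_card by metis+
qed

context pbw_generators
begin

lemma prod_list_in_span_words:
  assumes "set xs \<subseteq> span S"
  shows "prod_list xs \<in> span (prod_list ` {w. set w \<subseteq> S \<and> length w = length xs})"
  using assms
proof (induction xs)
  case Nil
  show ?case by (intro span_base image_eqI[of _ _ "[]"]) simp_all
next
  case (Cons x xs)
  have x: "x \<in> span S" and xs: "prod_list xs \<in> span (prod_list ` {w. set w \<subseteq> S \<and> length w = length xs})"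
    using Cons by simp_all
  have "x * prod_list xs \<in> span (prod_list ` {w. set w \<subseteq> S \<and> length w = length (x # xs)})"
  proof (rule span_mult[OF x xs subspace_span])
    fix a b assume a: "a \<in> S" and "b \<in> prod_list ` {w. set w \<subseteq> S \<and> length w = length xs}"
    then obtain w where w: "b = prod_list w" "set w \<subseteq> S" "length w = length xs" by blast
    have "prod_list (a # w) \<in> span (prod_list ` {w. set w \<subseteq> S \<and> length w = length (x # xs)})"
      using a w by (intro span_base imageI) simp
    then show "a * b \<in> span (prod_list ` {w. set w \<subseteq> S \<and> length w = length (x # xs)})"
      using w by simp
  qed
  then show ?case by simp
qed

text \<open>
  The span of \<open>m\<close> generators produces all ordered words in them whose exponents are at most
  \<open>n div m\<close> in its \<open>n\<close>-th power, and these are independent.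
\<close>

lemma GKdim_ge:
  assumes S: "finite S" "S \<subseteq> \<Gamma>"
  shows "ereal (real (card S)) \<le> GKdim scale"
proof -
  let ?m = "card S"
  let ?P = "\<lambda>n. {prod_list xs |xs. set xs \<subseteq> span S \<and> length xs \<le> n}"
  have "(n div ?m + 1) ^ ?m \<le> dim (?P n)" for n
  proof -
    let ?W = "bounded_words \<Gamma> r S (n div ?m)"
    have len: "length w \<le> n" if "w \<in> ?W" for w
    proof -
      have "length w = (\<Sum>x\<in>set w. count (mset w) x)"
        by (metis set_mset_mset size_mset size_multiset_overloaded_eq)
      also have "\<dots> \<le> (\<Sum>x\<in>set w. n div ?m)"
        using that by (intro sum_mono) (auto simp: bounded_words_def)
      also have "\<dots> \<le> ?m * (n div ?m)"
        using that S(1) by (auto simp: bounded_words_def intro: card_mono)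
      also have "\<dots> \<le> n" by simp
      finally show ?thesis .
    qed
    have "?W \<subseteq> ordered_words \<Gamma> r" by (auto simp: bounded_words_def)
    then have "inj_on prod_list ?W" "independent (prod_list ` ?W)"
      by (rule inj_on_subset[OF inj_on_ordered_words],
          rule independent_mono[OF independent_ordered_words image_mono])
    have "prod_list ` ?W \<subseteq> ?P n"
    proof
      fix p assume "p \<in> prod_list ` ?W"
      then obtain w where "p = prod_list w" "w \<in> ?W" by blast
      moreover from this have "set w \<subseteq> span S"
        using span_superset[of S] by (auto simp: bounded_words_def)
      ultimately show "p \<in> ?P n" using len by blast
    qed
    obtain B where B: "B \<subseteq> ?P n" "independent B" "?P n \<subseteq> span B" "card B = dim (?P n)"
      using basis_exists by blast
    let ?L = "prod_list ` {w. set w \<subseteq> S \<and> length w \<le> n}"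
    have L: "finite ?L" using finite_lists_length_le[OF S(1)] by simp
    have "B \<subseteq> span ?L"
    proof
      fix p assume "p \<in> B"
      then obtain xs where xs: "p = prod_list xs" "set xs \<subseteq> span S" "length xs \<le> n" using B(1) by blast
      have "span (prod_list ` {w. set w \<subseteq> S \<and> length w = length xs}) \<subseteq> span ?L"
        using xs(3) by (intro span_mono image_mono) auto
      then show "p \<in> span ?L" using prod_list_in_span_words[OF xs(2)] xs(1) by blast
    qed
    then have "finite B" using independent_span_bound[OF L B(2)] by blast
    moreover have "prod_list ` ?W \<subseteq> span B" using \<open>prod_list ` ?W \<subseteq> ?P n\<close> B(3) by blast
    ultimately have "card (prod_list ` ?W) \<le> card B"
      using independent_span_bound[OF _ \<open>independent (prod_list ` ?W)\<close>] by blast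
    then show ?thesis
      using bounded_words_card(2)[OF linear_order S] B(4) \<open>inj_on prod_list ?W\<close>
      by (simp add: card_image)
  qed
  then have "ereal (real ?m) \<le> limsup (\<lambda>n. ereal (log (real n) (real (dim (?P n)))))"
    by (rule limsup_log_ge)
  also have "\<dots> \<le> GKdim scale"
    unfolding GKdim_def by (rule SUP_upper) (use S(1) in blast)
  finally show ?thesis .
qed

text \<open>
  The filtration by degree: a finite-dimensional subspace lies in some stage \<open>N\<close>, hence its
  \<open>n\<close>-th power in stage \<open>N * n\<close>, whose dimension is the number of ordered words of at most
  that degree.
\<close>

definition degree_filtration :: "nat \<Rightarrow> 'h set" where
  "degree_filtration d = span (prod_list ` {w \<in> ordered_words \<Gamma> r. wdeg w \<le> d})"

lemma degree_filtration_mono: "d \<le> e \<Longrightarrow> degree_filtration d \<subseteq> degree_filtration e"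
  unfolding degree_filtration_def by (intro span_mono) auto

lemma subspace_degree_filtration: "subspace (degree_filtration d)"
  unfolding degree_filtration_def by (rule subspace_span)

lemma gr_degree_filtration: "i \<le> d \<Longrightarrow> gr i \<subseteq> degree_filtration d"
  using gr_in_span span_mono[of "ordered_products i" "prod_list ` {w \<in> ordered_words \<Gamma> r. wdeg w \<le> d}"]
  unfolding degree_filtration_def by fastforce

lemma degree_filtration_mult:
  assumes "x \<in> degree_filtration d" "y \<in> degree_filtration e"
  shows "x * y \<in> degree_filtration (d + e)"
  using assms unfolding degree_filtration_def[of d] degree_filtration_def[of e]
proof (rule span_mult[OF _ _ subspace_degree_filtration])
  fix a b assume "a \<in> prod_list ` {w \<in> ordered_words \<Gamma> r. wdeg w \<le> d}"
    "b \<in> prod_list ` {w \<in> ordered_words \<Gamma> r. wdeg w \<le> e}"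
  then obtain v w where "a = prod_list v" "set v \<subseteq> \<Gamma>" "wdeg v \<le> d"
    "b = prod_list w" "set w \<subseteq> \<Gamma>" "wdeg w \<le> e" by (auto simp: ordered_words_def)
  then have "a * b \<in> gr (wdeg v + wdeg w)" "wdeg v + wdeg w \<le> d + e"
    by (auto intro: gr_mult word_gr)
  then show "a * b \<in> degree_filtration (d + e)" using gr_degree_filtration by blast
qed

lemma degree_filtration_exhaust: "\<exists>d. x \<in> degree_filtration d"
proof -
  obtain d where "\<forall>n\<in>{n. hcomp n x \<noteq> 0}. n \<le> d"
    using finite_hcomp[of x] finite_nat_set_iff_bounded_le by metis
  then have "(\<Sum>n | hcomp n x \<noteq> 0. hcomp n x) \<in> degree_filtration d"
    using gr_degree_filtration hcomp_in_gr
    by (intro subspace_sum[OF subspace_degree_filtration]) blast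
  then show ?thesis by (auto simp: sum_hcomp)
qed

lemma finite_subset_degree_filtration:
  assumes "finite B"
  obtains d where "B \<subseteq> degree_filtration d"
proof -
  have "\<exists>d. B \<subseteq> degree_filtration d"
    using assms
  proof (induction B)
    case (insert x B)
    then obtain d where d: "B \<subseteq> degree_filtration d" by blast
    obtain e where e: "x \<in> degree_filtration e" using degree_filtration_exhaust by blast
    have "insert x B \<subseteq> degree_filtration (max d e)"
      using d e degree_filtration_mono[of d "max d e"] degree_filtration_mono[of e "max d e"] by auto
    then show ?case by blast
  qed simp
  then show thesis using that by blast
qed

lemma prod_list_degree_filtration:
  assumes "set xs \<subseteq> degree_filtration d"
  shows "prod_list xs \<in> degree_filtration (d * length xs)"
  using assms
proof (induction xs)
  case Nil
  then show ?case using gr_degree_filtration[of 0 0] gr_one by auto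
next
  case (Cons x xs)
  then show ?case using degree_filtration_mult[of x d "prod_list xs" "d * length xs"] by simp
qed

lemma GKdim_le:
  assumes fin: "finite \<Gamma>"
  shows "GKdim scale \<le> ereal (real (card \<Gamma>))"
  unfolding GKdim_def
proof (rule SUP_least)
  fix V assume "V \<in> {span B |B. finite B}"
  then obtain B where B: "V = span B" "finite B" by blast
  obtain N where N: "B \<subseteq> degree_filtration N" using finite_subset_degree_filtration[OF B(2)] .
  have V: "V \<subseteq> degree_filtration N"
    unfolding B(1) by (rule span_minimal[OF N subspace_degree_filtration])
  let ?P = "\<lambda>n. {prod_list xs |xs. set xs \<subseteq> V \<and> length xs \<le> n}"
  have "real (dim (?P n)) \<le> (real (N + 1) * real n) ^ card \<Gamma>" if n: "2 \<le> n" for n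
  proof -
    let ?W = "{w \<in> ordered_words \<Gamma> r. wdeg w \<le> N * n}"
    have "?W \<subseteq> bounded_words \<Gamma> r \<Gamma> (N * n)"
    proof
      fix w assume w: "w \<in> ?W"
      then have "set w \<subseteq> \<Gamma>" by (simp add: ordered_words_def)
      then have "length w \<le> N * n" using length_le_wdeg[of w] w by simp
      then have "count (mset w) x \<le> N * n" for x
        using count_le_size[of "mset w" x] by simp
      then show "w \<in> bounded_words \<Gamma> r \<Gamma> (N * n)"
        using w \<open>set w \<subseteq> \<Gamma>\<close> by (simp add: bounded_words_def)
    qed
    then have W: "finite ?W" "card ?W \<le> (N * n + 1) ^ card \<Gamma>"
      using bounded_words_card[OF linear_order fin, of "N * n"] card_mono finite_subset
      by (blast, metis order_refl)
    have "?P n \<subseteq> span (prod_list ` ?W)"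
    proof
      fix p assume "p \<in> ?P n"
      then obtain xs where xs: "p = prod_list xs" "set xs \<subseteq> V" "length xs \<le> n" by blast
      then have "p \<in> degree_filtration (N * length xs)" using prod_list_degree_filtration V by blast
      then have "p \<in> degree_filtration (N * n)"
        using degree_filtration_mono[of "N * length xs" "N * n"] xs(3) by auto
      then show "p \<in> span (prod_list ` ?W)" by (simp add: degree_filtration_def)
    qed
    then have "dim (?P n) \<le> card (prod_list ` ?W)" by (rule dim_le_card[OF _ finite_imageI[OF W(1)]])
    also have "\<dots> \<le> card ?W" by (rule card_image_le[OF W(1)])
    also have "\<dots> \<le> (N * n + 1) ^ card \<Gamma>" by (rule W(2))
    also have "\<dots> \<le> ((N + 1) * n) ^ card \<Gamma>" using n by (intro power_mono) simp_all
    finally have "real (dim (?P n)) \<le> real (((N + 1) * n) ^ card \<Gamma>)" by (simp only: of_nat_le_iff)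
    then show ?thesis by (simp only: of_nat_mult of_nat_power)
  qed
  then show "limsup (\<lambda>n. ereal (log (real n) (real (dim (?P n))))) \<le> ereal (real (card \<Gamma>))"
    by (rule limsup_log_le) simp_all
qed

lemma GKdim_eq: "finite \<Gamma> \<Longrightarrow> GKdim scale = ereal (real (card \<Gamma>))"
  using GKdim_le GKdim_ge[of \<Gamma>] by (simp add: antisym)

lemma GKdim_finite_iff: "GKdim scale < \<infinity> \<longleftrightarrow> finite \<Gamma>"
proof
  assume "GKdim scale < \<infinity>"
  show "finite \<Gamma>"
  proof (rule ccontr)
    assume inf: "infinite \<Gamma>"
    have "ereal (real n) \<le> GKdim scale" for n
    proof -
      obtain S where "finite S" "card S = n" "S \<subseteq> \<Gamma>"
        using infinite_arbitrarily_large[OF inf] by blast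
      then show ?thesis using GKdim_ge[of S] by simp
    qed
    then have "GKdim scale = \<infinity>"
      by (intro ereal_top) (meson ereal_less_eq(3) order_trans real_arch_simple)
    then show False using \<open>GKdim scale < \<infinity>\<close> by simp
  qed
qed (simp add: GKdim_eq)

end

section \<open>The structure theorem\<close>

theorem theoremA:
  fixes scale :: "'k::field_char_0 \<Rightarrow> 'h::ring_1 \<Rightarrow> 'h"
    and comult :: "'h \<Rightarrow> ('h \<times> 'h \<Rightarrow>\<^sub>0 'k)"
    and counit :: "'h \<Rightarrow> 'k"
    and antipode :: "'h \<Rightarrow> 'h"
    and gr :: "nat \<Rightarrow> 'h set"
  assumes "connected_graded_hopf_algebra scale comult counit antipode gr"
  shows "\<exists>(\<Gamma> :: 'h set) (z :: 'h \<Rightarrow> 'h) (r :: 'h rel).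
    linear_order_on \<Gamma> r \<and>
    (\<forall>\<gamma>\<in>\<Gamma>. \<exists>n>0. z \<gamma> \<in> gr n) \<and>
    (\<forall>\<gamma>\<in>\<Gamma>. comult (z \<gamma>) - (pure2 1 (z \<gamma>) + pure2 (z \<gamma>) 1) \<in>
       tensor2_span scale
         (\<Union>(i, j) \<in> {(i, j). i > 0 \<and> j > 0 \<and> i + j = hdeg gr (z \<gamma>)}.
            (subalgebra_below scale \<Gamma> r z \<gamma> \<inter> gr i) \<times> (subalgebra_below scale \<Gamma> r z \<gamma> \<inter> gr j))) \<and>
    (\<forall>\<gamma>\<in>\<Gamma>. \<forall>\<delta>\<in>\<Gamma>. (\<delta>, \<gamma>) \<in> r \<and> \<delta> \<noteq> \<gamma> \<longrightarrow>
       z \<gamma> * z \<delta> - z \<delta> * z \<gamma> \<in>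
         subalgebra_below scale \<Gamma> r z \<gamma> \<inter> gr (hdeg gr (z \<gamma>) + hdeg gr (z \<delta>))) \<and>
    inj_on (\<lambda>w. prod_list (map z w)) (ordered_words \<Gamma> r) \<and>
    is_basis scale ((\<lambda>w. prod_list (map z w)) ` ordered_words \<Gamma> r) \<and>
    (GKdim scale < \<infinity> \<longleftrightarrow> finite \<Gamma>) \<and>
    (finite \<Gamma> \<longrightarrow> GKdim scale = ereal (real (card \<Gamma>)))"
proof -
  interpret H: connected_graded_hopf_algebra scale comult counit antipode gr by (rule assms)
  interpret P: pbw_generators scale comult counit antipode gr H.generators H.generator_order
  proof unfold_locales
    show "wf {(\<delta>, \<gamma>). \<gamma> \<in> H.generators \<inter> H.below d \<and>
      \<delta> \<in> H.lower_generators \<gamma> \<inter> H.below d}" for d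
      by (rule H.wf_generators_below)
  qed (use H.linear_order_generators H.generators_pos H.generator_comult H.generator_commutator
      H.generator_not_in_Alg_lower H.generators_generate in auto)
  have below: "subalgebra_below scale H.generators H.generator_order (\<lambda>x. x) \<gamma> = H.Alg (P.lower \<gamma>)"
    for \<gamma>
    by (simp add: subalgebra_below_def)
  show ?thesis
  proof (rule exI[of _ H.generators], rule exI[of _ "\<lambda>x. x"], rule exI[of _ H.generator_order],
      unfold below H.positive_pairs_def[symmetric] list.map_ident, intro conjI ballI impI)
    show "\<exists>n>0. \<gamma> \<in> gr n" if "\<gamma> \<in> H.generators" for \<gamma>
      using P.deg_pos[OF that] P.generator_gr[OF that] by blast
    show "\<gamma> * \<delta> - \<delta> * \<gamma> \<in> H.Alg (P.lower \<gamma>) \<inter> gr (hdeg gr \<gamma> + hdeg gr \<delta>)"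
      if "\<gamma> \<in> H.generators" "\<delta> \<in> H.generators" "(\<delta>, \<gamma>) \<in> H.generator_order \<and> \<delta> \<noteq> \<gamma>" for \<gamma> \<delta>
      using that P.triangular_commutator[of \<gamma> \<delta>]
        H.commutator_in_gr[OF P.generator_gr[OF that(1)] P.generator_gr[OF that(2)]] by simp
    show "is_basis scale (prod_list ` ordered_words H.generators H.generator_order)"
      unfolding is_basis_def using P.independent_ordered_words P.span_ordered_words by blast
  qed (fact P.linear_order P.triangular_comult P.inj_on_ordered_words P.GKdim_finite_iff P.GKdim_eq)+
qed

end
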